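(* Let $\mathscr H$ be a real separable Hilbert space with $\dim(\mathscr H)\ge2$ and let $q,t\in\mathbb R$ with $|q|<t\le1$. Let $\Gamma_{q,t}\subseteq\mathscr B(\mathscr F_{q,t})$ be the weak closure of the unital $\ast$-algebra generated by $\{s_{q,t}(h)\mid h\in\mathscr H\}$, where $s_{q,t}(h)=a_{q,t}(h)+a_{q,t}(h)^\ast$. Then the vacuum expectation state $\varphi_{q,t}$ is tracial on $\Gamma_{q,t}$ (i.e. $\varphi_{q,t}(xy)=\varphi_{q,t}(yx)$ for all $x,y\in\Gamma_{q,t}$) if and only if $t=1$.
   Context: $\mathscr H_{\mathbb C}$ is the complexification of $\mathscr H$, with inner product extended to be conjugate-linear in the first and linear in the second argument. $\mathscr F=\mathbb C\Omega\oplus\bigoplus_{n\ge1}\mathscr H_{\mathbb C}^{\otimes n}$ (algebraic direct sum and tensor products), $\Omega$ a distinguished unit vector; $\langle\cdot,\cdot\rangle_0$ is the usual full Fock space inner product on $\mathscr F$. For $\pi\in S_n$, $\mathrm{inv}(\pi)$ is the number of pairs $i<j$ with $\pi(i)>\pi(j)$, $\mathrm{cinv}(\pi)$ the number of pairs $i<j$ with $\pi(i)<\pi(j)$, and $U_\pi^{(n)}h_1\otimes\cdots\otimes h_n=h_{\pi(1)}\otimes\cdots\otimes h_{\pi(n)}$. Put $P_{q,t}=\bigoplus_{n\ge0}P_{q,t}^{(n)}$, $P_{q,t}^{(n)}=\sum_{\pi\in S_n}q^{\mathrm{inv}(\pi)}t^{\mathrm{cinv}(\pi)}U^{(n)}_\pi$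 (identity for $n=0$) and $\langle\eta,\xi\rangle_{q,t}=\langle\eta,P_{q,t}\xi\rangle_0$, an inner product on $\mathscr F$ when $|q|<t$. The $(q,t)$-Fock space $\mathscr F_{q,t}$ is the completion of $\mathscr F$ for $\langle\cdot,\cdot\rangle_{q,t}$. For $f\in\mathscr H$, $a_{q,t}(f)^\ast$ and $a_{q,t}(f)$ are the linear operators (bounded on $\mathscr F_{q,t}$ and mutually adjoint for $|q|<t\le1$) with $a_{q,t}(f)^\ast\Omega=f$, $a_{q,t}(f)^\ast h_1\otimes\cdots\otimes h_n=f\otimes h_1\otimes\cdots\otimes h_n$, $a_{q,t}(f)\Omega=0$, $a_{q,t}(f)h_1\otimes\cdots\otimes h_n=\sum_{k=1}^nq^{k-1}t^{n-k}\langle f,h_k\rangle_{\mathscr H}h_1\otimes\cdots\otimes\breve h_k\otimes\cdots\otimes h_n$ ($\breve h_k$: deleted). The vacuum state is $\varphi_{q,t}(b)=\langle\Omega,b\Omega\rangle_{q,t}$. Convention: $0^0=1$. "Weak" means the weak operator topology. *)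

theory Defs
  imports
    "HOL-Analysis.Analysis"
    "HOL-Library.Poly_Mapping"
    "HOL-Combinatorics.Permutations"
begin

section \<open>Complex vector spaces and complex Hilbert spaces\<close>

class complex_vector = ab_group_add +
  fixes scaleC :: "complex \<Rightarrow> 'a \<Rightarrow> 'a"  (infixr \<open>*\<^sub>C\<close> 75)
  assumes scaleC_add_right: "c *\<^sub>C (x + y) = c *\<^sub>C x + c *\<^sub>C y"
    and scaleC_add_left: "(c + d) *\<^sub>C x = c *\<^sub>C x + d *\<^sub>C x"
    and scaleC_scaleC: "c *\<^sub>C d *\<^sub>C x = (c * d) *\<^sub>C x"
    and scaleC_one: "1 *\<^sub>C x = x"

text \<open>Inner products are conjugate-linear in the first argument.\<close>

class complex_inner = complex_vector +
  fixes cinner :: "'a \<Rightarrow> 'a \<Rightarrow> complex"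
  assumes cinner_commute: "cinner x y = cnj (cinner y x)"
    and cinner_add_right: "cinner x (y + z) = cinner x y + cinner x z"
    and cinner_scaleC_right: "cinner x (c *\<^sub>C y) = c * cinner x y"
    and cinner_ge_zero: "0 \<le> Re (cinner x x)"
    and cinner_eq_zero_iff: "cinner x x = 0 \<longleftrightarrow> x = 0"

class complex_hilbert = complex_inner + real_normed_vector + complete_space +
  assumes scaleR_scaleC: "scaleR r x = complex_of_real r *\<^sub>C x"
    and norm_eq_sqrt_cinner: "norm x = sqrt (Re (cinner x x))"

definition clinear :: "('a::complex_vector \<Rightarrow> 'b::complex_vector) \<Rightarrow> bool" where
  "clinear f \<longleftrightarrow> (\<forall>x y. f (x + y) = f x + f y) \<and> (\<forall>c x. f (c *\<^sub>C x) = c *\<^sub>C f x)"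

lemma scaleC_zero_right [simp]: "c *\<^sub>C (0 :: 'a::complex_vector) = 0"
  using scaleC_add_right[of c "0::'a" 0] by simp

lemma scaleC_zero_left [simp]: "0 *\<^sub>C (x :: 'a::complex_vector) = 0"
  using scaleC_add_left[of 0 0 x] by simp

lemma scaleC_sum_right: "c *\<^sub>C (\<Sum>i\<in>I. f i :: 'a::complex_vector) = (\<Sum>i\<in>I. c *\<^sub>C f i)"
  by (induction I rule: infinite_finite_induct) (simp_all add: scaleC_add_right)

instantiation complex :: complex_vector
begin

definition scaleC_complex :: "complex \<Rightarrow> complex \<Rightarrow> complex" where
  "scaleC_complex c x = c * x"

instance
  by standard (simp_all add: scaleC_complex_def algebra_simps)

end

section \<open>The complexification of a real inner product space\<close>

datatype 'a complexification = Cplx (re_part: 'a) (im_part: 'a)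

instantiation complexification :: (real_inner) complex_inner
begin

definition zero_complexification :: "'a complexification" where
  "zero_complexification = Cplx 0 0"

definition plus_complexification ::
    "'a complexification \<Rightarrow> 'a complexification \<Rightarrow> 'a complexification" where
  "plus_complexification x y = Cplx (re_part x + re_part y) (im_part x + im_part y)"

definition minus_complexification ::
    "'a complexification \<Rightarrow> 'a complexification \<Rightarrow> 'a complexification" where
  "minus_complexification x y = Cplx (re_part x - re_part y) (im_part x - im_part y)"

definition uminus_complexification :: "'a complexification \<Rightarrow> 'a complexification" where
  "uminus_complexification x = Cplx (- re_part x) (- im_part x)"

definition scaleC_complexification ::
    "complex \<Rightarrow> 'a complexification \<Rightarrow> 'a complexification" where
  "scaleC_complexification c x =
     Cplx (Re c *\<^sub>R re_part x - Im c *\<^sub>R im_part x) (Re c *\<^sub>R im_part x + Im c *\<^sub>R re_part x)"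

definition cinner_complexification ::
    "'a complexification \<Rightarrow> 'a complexification \<Rightarrow> complex" where
  "cinner_complexification x y =
     Complex (re_part x \<bullet> re_part y + im_part x \<bullet> im_part y)
             (re_part x \<bullet> im_part y - im_part x \<bullet> re_part y)"

instance
proof
  fix x y z :: "'a complexification" and c d :: complex
  note defs = zero_complexification_def plus_complexification_def minus_complexification_def
    uminus_complexification_def scaleC_complexification_def cinner_complexification_def
  show "x + y + z = x + (y + z)" "x + y = y + x" "0 + x = x" "- x + x = 0" "x - y = x + - y"
    by (simp_all add: defs algebra_simps)
  show "c *\<^sub>C (x + y) = c *\<^sub>C x + c *\<^sub>C y" "(c + d) *\<^sub>C x = c *\<^sub>C x + d *\<^sub>C x"
    "c *\<^sub>C d *\<^sub>C x = (c * d) *\<^sub>C x" "1 *\<^sub>C x = x"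
    by (simp_all add: defs algebra_simps)
  show "cinner x y = cnj (cinner y x)" "cinner x (y + z) = cinner x y + cinner x z"
    "cinner x (c *\<^sub>C y) = c * cinner x y" "0 \<le> Re (cinner x x)"
    by (simp_all add: defs complex_eq_iff inner_add_right inner_diff_right inner_commute algebra_simps)
  show "cinner x x = 0 \<longleftrightarrow> x = 0"
    by (cases x) (simp add: defs complex_eq_iff add_nonneg_eq_0_iff inner_commute)
qed

end

definition to_cplx :: "'a::real_inner \<Rightarrow> 'a complexification" where
  "to_cplx h = Cplx h 0"

section \<open>The algebraic full Fock space\<close>

text \<open>
  The algebraic direct sum of all algebraic tensor powers of a complex vector space is the
  quotient of the free complex vector space on words by the multilinearity relations;
  words of length \<open>n\<close> span the \<open>n\<close>-th tensor power.
\<close>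

inductive tensor_null :: "('v::complex_vector list \<Rightarrow>\<^sub>0 complex) \<Rightarrow> bool" where
  zero: "tensor_null 0"
| plus: "tensor_null p \<Longrightarrow> tensor_null r \<Longrightarrow> tensor_null (p + r)"
| additive: "i < length w \<Longrightarrow>
    tensor_null (Poly_Mapping.single (w[i := x + y]) c
      - Poly_Mapping.single (w[i := x]) c - Poly_Mapping.single (w[i := y]) c)"
| homogeneous: "i < length w \<Longrightarrow>
    tensor_null (Poly_Mapping.single (w[i := a *\<^sub>C x]) c - Poly_Mapping.single (w[i := x]) (a * c))"

definition tensor_eq ::
    "('v::complex_vector list \<Rightarrow>\<^sub>0 complex) \<Rightarrow> ('v list \<Rightarrow>\<^sub>0 complex) \<Rightarrow> bool" where
  "tensor_eq p r \<longleftrightarrow> tensor_null (p - r)"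

definition free_scale :: "complex \<Rightarrow> ('b \<Rightarrow>\<^sub>0 complex) \<Rightarrow> ('b \<Rightarrow>\<^sub>0 complex)" where
  "free_scale c p = Poly_Mapping.map ((*) c) p"

lemma lookup_free_scale: "Poly_Mapping.lookup (free_scale c p) k = c * Poly_Mapping.lookup p k"
  by (simp add: free_scale_def map.rep_eq when_def)

lemma free_scale_simps:
  "free_scale c 0 = 0" "free_scale c (p + r) = free_scale c p + free_scale c r"
  "free_scale c (p - r) = free_scale c p - free_scale c r"
  "free_scale c (Poly_Mapping.single w d) = Poly_Mapping.single w (c * d)"
  "free_scale (c + d) p = free_scale c p + free_scale d p"
  "free_scale c (free_scale d p) = free_scale (c * d) p" "free_scale 1 p = p"
  "free_scale (- 1) p = - p"
  by (auto intro!: poly_mapping_eqI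
      simp: lookup_free_scale lookup_add lookup_minus lookup_single algebra_simps when_def)

lemma tensor_null_scale: "tensor_null p \<Longrightarrow> tensor_null (free_scale c p)"
proof (induction rule: tensor_null.induct)
  case (homogeneous i w a x d)
  then show ?case
    using tensor_null.homogeneous[of i w a x "c * d"]
    by (simp add: free_scale_simps mult.left_commute)
qed (auto simp: free_scale_simps intro: tensor_null.intros)

lemma tensor_null_uminus: "tensor_null p \<Longrightarrow> tensor_null (- p)"
  using tensor_null_scale[of p "- 1"] by (simp add: free_scale_simps)

lemma equivp_tensor_eq:
  "equivp (tensor_eq :: ('v::complex_vector list \<Rightarrow>\<^sub>0 complex) \<Rightarrow> _)"
proof (rule equivpI)
  show "reflp (tensor_eq :: ('v list \<Rightarrow>\<^sub>0 complex) \<Rightarrow> _)"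
    by (auto simp: reflp_def tensor_eq_def intro: tensor_null.zero)
  show "symp (tensor_eq :: ('v list \<Rightarrow>\<^sub>0 complex) \<Rightarrow> _)"
    unfolding symp_def tensor_eq_def by (metis minus_diff_eq tensor_null_uminus)
  show "transp (tensor_eq :: ('v list \<Rightarrow>\<^sub>0 complex) \<Rightarrow> _)"
  proof (rule transpI)
    fix p r s :: "'v list \<Rightarrow>\<^sub>0 complex"
    assume "tensor_eq p r" "tensor_eq r s"
    then have "tensor_null ((p - r) + (r - s))"
      unfolding tensor_eq_def by (rule tensor_null.plus)
    then show "tensor_eq p s" by (simp add: tensor_eq_def)
  qed
qed

quotient_type (overloaded) 'v tensor_algebra =
    "'v::complex_vector list \<Rightarrow>\<^sub>0 complex" / tensor_eq
  by (rule equivp_tensor_eq)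

instantiation tensor_algebra :: (complex_vector) complex_vector
begin

lift_definition zero_tensor_algebra :: "'a tensor_algebra" is 0 .

lift_definition plus_tensor_algebra ::
    "'a tensor_algebra \<Rightarrow> 'a tensor_algebra \<Rightarrow> 'a tensor_algebra" is "(+)"
  unfolding tensor_eq_def by (metis add_diff_add tensor_null.plus)

lift_definition uminus_tensor_algebra :: "'a tensor_algebra \<Rightarrow> 'a tensor_algebra" is uminus
  unfolding tensor_eq_def by (metis minus_diff_minus tensor_null_uminus)

definition minus_tensor_algebra ::
    "'a tensor_algebra \<Rightarrow> 'a tensor_algebra \<Rightarrow> 'a tensor_algebra" where
  "minus_tensor_algebra x y = x + - y"

lift_definition scaleC_tensor_algebra ::
    "complex \<Rightarrow> 'a tensor_algebra \<Rightarrow> 'a tensor_algebra" is free_scale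
  unfolding tensor_eq_def by (metis free_scale_simps(3) tensor_null_scale)

instance
proof
  fix x y z :: "'a tensor_algebra" and c d :: complex
  have eq: "tensor_eq p r" if "p = r" for p r :: "'a list \<Rightarrow>\<^sub>0 complex"
    using that by (simp add: tensor_eq_def tensor_null.zero)
  show "x + y + z = x + (y + z)" "x + y = y + x" "0 + x = x" "- x + x = 0"
    by (transfer, rule eq, simp add: algebra_simps)+
  show "x - y = x + - y" by (simp add: minus_tensor_algebra_def)
  show "c *\<^sub>C (x + y) = c *\<^sub>C x + c *\<^sub>C y" "(c + d) *\<^sub>C x = c *\<^sub>C x + d *\<^sub>C x"
    "c *\<^sub>C d *\<^sub>C x = (c * d) *\<^sub>C x" "1 *\<^sub>C x = x"
    by (transfer, rule eq, simp add: free_scale_simps)+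
qed

end

lift_definition tensor :: "'v::complex_vector list \<Rightarrow> 'v tensor_algebra" is
  "\<lambda>w. Poly_Mapping.single w 1" .

text \<open>
  Universal property: a function on words that is linear in every letter extends uniquely to
  a linear map.  (The branch \<open>0\<close> for other functions is never used below.)
\<close>

definition multilinear_words :: "('v::complex_vector list \<Rightarrow> 'b::complex_vector) \<Rightarrow> bool" where
  "multilinear_words f \<longleftrightarrow> (\<forall>w i. i < length w \<longrightarrow>
     (\<forall>x y. f (w[i := x + y]) = f (w[i := x]) + f (w[i := y])) \<and>
     (\<forall>c x. f (w[i := c *\<^sub>C x]) = c *\<^sub>C f (w[i := x])))"

definition free_extend :: "('w \<Rightarrow> 'b::complex_vector) \<Rightarrow> ('w \<Rightarrow>\<^sub>0 complex) \<Rightarrow> 'b" where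
  "free_extend f p = (\<Sum>w\<in>Poly_Mapping.keys p. Poly_Mapping.lookup p w *\<^sub>C f w)"

lemma free_extend_superset:
  assumes "finite A" "Poly_Mapping.keys p \<subseteq> A"
  shows "free_extend f p = (\<Sum>w\<in>A. Poly_Mapping.lookup p w *\<^sub>C f w)"
  unfolding free_extend_def using assms
  by (intro sum.mono_neutral_left) (auto simp: in_keys_iff)

lemma free_extend_add: "free_extend f (p + r) = free_extend f p + free_extend f r"
proof -
  let ?A = "Poly_Mapping.keys p \<union> Poly_Mapping.keys r"
  have "free_extend f s = (\<Sum>w\<in>?A. Poly_Mapping.lookup s w *\<^sub>C f w)" if "s \<in> {p, r, p + r}" for s
    using that keys_add[of p r] by (intro free_extend_superset) auto
  then show ?thesis
    by (simp add: lookup_add scaleC_add_left sum.distrib)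
qed

lemma free_extend_scale: "free_extend f (free_scale c p) = c *\<^sub>C free_extend f p"
proof -
  have "free_extend f (free_scale c p)
      = (\<Sum>w\<in>Poly_Mapping.keys p. Poly_Mapping.lookup (free_scale c p) w *\<^sub>C f w)"
    by (rule free_extend_superset) (auto simp: in_keys_iff lookup_free_scale)
  then show ?thesis
    by (simp add: lookup_free_scale scaleC_scaleC scaleC_sum_right free_extend_def)
qed

lemma free_extend_diff: "free_extend f (p - r) = free_extend f p - free_extend f r"
  using free_extend_add[of f "p - r" r] by simp

lemma free_extend_single: "free_extend f (Poly_Mapping.single w c) = c *\<^sub>C f w"
  by (subst free_extend_superset[of "{w}"]) auto

lemma free_extend_zero: "free_extend f 0 = 0"
  by (simp add: free_extend_def)

lemma free_extend_null:
  assumes "multilinear_words f" "tensor_null p"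
  shows "free_extend f p = 0"
  using assms(2,1)
proof (induction rule: tensor_null.induct)
  case (additive i w x y c)
  then show ?case
    by (simp add: free_extend_diff free_extend_single multilinear_words_def scaleC_add_right)
next
  case (homogeneous i w a x c)
  then show ?case
    by (simp add: free_extend_diff free_extend_single multilinear_words_def scaleC_scaleC mult.commute)
qed (simp_all add: free_extend_zero free_extend_add)

lift_definition tensor_lift ::
    "('v::complex_vector list \<Rightarrow> 'b::complex_vector) \<Rightarrow> 'v tensor_algebra \<Rightarrow> 'b" is
  "\<lambda>f p. if multilinear_words f then free_extend f p else 0"
  unfolding tensor_eq_def by (metis eq_iff_diff_eq_0 free_extend_diff free_extend_null)

lemma tensor_lift_tensor: "multilinear_words f \<Longrightarrow> tensor_lift f (tensor w) = f w"
  by transfer (simp add: free_extend_single scaleC_one)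

lemma clinear_tensor_lift: "clinear (tensor_lift f)"
  unfolding clinear_def
  by (intro conjI allI; transfer) (simp_all add: free_extend_add free_extend_scale)

lemma tensor_update_add:
  "i < length w \<Longrightarrow> tensor (w[i := x + y]) = tensor (w[i := x]) + tensor (w[i := y])"
  by transfer (use tensor_null.additive[of _ _ _ _ 1] in \<open>simp add: tensor_eq_def diff_diff_eq\<close>)

lemma tensor_update_scaleC:
  "i < length w \<Longrightarrow> tensor (w[i := c *\<^sub>C x]) = c *\<^sub>C tensor (w[i := x])"
  by transfer (use tensor_null.homogeneous[of _ _ _ _ 1] in \<open>simp add: tensor_eq_def free_scale_simps\<close>)

type_synonym 'a fock = "'a complexification tensor_algebra"

definition vacuum :: "'a::real_inner fock" where
  "vacuum = tensor []"

definition word_inner :: "'a::real_inner complexification list \<Rightarrow> 'a complexification list \<Rightarrow> complex" where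
  "word_inner v w =
     (if length v = length w then \<Prod>i<length w. cinner (v ! i) (w ! i) else 0)"

text \<open>
  The inner lift is \<open>\<lambda>\<eta>. \<langle>tensor v, \<eta>\<rangle>\<close>; its conjugate is linear in \<open>v\<close>, hence the outer
  lift is linear in \<open>\<xi>\<close> and conjugate-linear in \<open>\<eta>\<close>.
\<close>

definition inner0 :: "'a::real_inner fock \<Rightarrow> 'a fock \<Rightarrow> complex" where
  "inner0 \<eta> \<xi> = tensor_lift (\<lambda>v. cnj (tensor_lift (word_inner v) \<eta>)) \<xi>"

section \<open>The \<open>(q,t)\<close>-deformation\<close>

definition inv_num :: "nat \<Rightarrow> (nat \<Rightarrow> nat) \<Rightarrow> nat" where
  "inv_num n \<pi> = card {(i, j). i < j \<and> j < n \<and> \<pi> i > \<pi> j}"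

definition cinv_num :: "nat \<Rightarrow> (nat \<Rightarrow> nat) \<Rightarrow> nat" where
  "cinv_num n \<pi> = card {(i, j). i < j \<and> j < n \<and> \<pi> i < \<pi> j}"

text \<open>\<open>U\<^sub>\<pi>\<close> on the \<open>n\<close>-th tensor power, extended by zero to the other summands.\<close>

definition U_perm :: "nat \<Rightarrow> (nat \<Rightarrow> nat) \<Rightarrow> 'a::real_inner fock \<Rightarrow> 'a fock" where
  "U_perm n \<pi> = tensor_lift (\<lambda>w. if length w = n then tensor (permute_list \<pi> w) else 0)"

definition P_level :: "real \<Rightarrow> real \<Rightarrow> nat \<Rightarrow> 'a::real_inner fock \<Rightarrow> 'a fock" where
  "P_level q t n \<xi> = (\<Sum>\<pi> | \<pi> permutes {..<n}.
     complex_of_real (q ^ inv_num n \<pi> * t ^ cinv_num n \<pi>) *\<^sub>C U_perm n \<pi> \<xi>)"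

definition P_qt :: "real \<Rightarrow> real \<Rightarrow> 'a::real_inner fock \<Rightarrow> 'a fock" where
  "P_qt q t = tensor_lift (\<lambda>w. P_level q t (length w) (tensor w))"

definition inner_qt :: "real \<Rightarrow> real \<Rightarrow> 'a::real_inner fock \<Rightarrow> 'a fock \<Rightarrow> complex" where
  "inner_qt q t \<eta> \<xi> = inner0 \<eta> (P_qt q t \<xi>)"

definition creation :: "'a::real_inner \<Rightarrow> 'a fock \<Rightarrow> 'a fock" where
  "creation f = tensor_lift (\<lambda>w. tensor (to_cplx f # w))"

text \<open>Positions are counted from \<open>0\<close>, so the \<open>k\<close>-th summand carries \<open>q\<^sup>k t\<^sup>n\<^sup>-\<^sup>1\<^sup>-\<^sup>k\<close>.\<close>

definition annihilation_word ::
    "real \<Rightarrow> real \<Rightarrow> 'a::real_inner \<Rightarrow> 'a complexification list \<Rightarrow> 'a fock" where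
  "annihilation_word q t f w = (\<Sum>k<length w.
     (complex_of_real (q ^ k * t ^ (length w - 1 - k)) * cinner (to_cplx f) (w ! k)) *\<^sub>C
       tensor (take k w @ drop (Suc k) w))"

definition annihilation :: "real \<Rightarrow> real \<Rightarrow> 'a::real_inner \<Rightarrow> 'a fock \<Rightarrow> 'a fock" where
  "annihilation q t f = tensor_lift (annihilation_word q t f)"

subsection \<open>Values on elementary tensors\<close>

lemma multilinear_wordsI:
  assumes "\<And>w i x y. i < length w \<Longrightarrow> f (w[i := x + y]) = f (w[i := x]) + f (w[i := y])"
    and "\<And>w i c x. i < length w \<Longrightarrow> f (w[i := c *\<^sub>C x]) = c *\<^sub>C f (w[i := x])"
  shows "multilinear_words f"
  using assms unfolding multilinear_words_def by blast

lemma prod_list_update: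
  fixes g :: "nat \<Rightarrow> 'b \<Rightarrow> 'c::comm_monoid_mult"
  assumes "i < length w"
  shows "(\<Prod>j<length w. g j (w[i := x] ! j)) =
    g i x * (\<Prod>j\<in>{..<length w} - {i}. g j (w ! j))"
proof -
  have "(\<Prod>j<length w. g j (w[i := x] ! j)) =
      g i (w[i := x] ! i) * (\<Prod>j\<in>{..<length w} - {i}. g j (w[i := x] ! j))"
    using assms by (intro prod.remove) auto
  also have "(\<Prod>j\<in>{..<length w} - {i}. g j (w[i := x] ! j)) =
      (\<Prod>j\<in>{..<length w} - {i}. g j (w ! j))"
    by (intro prod.cong) auto
  finally show ?thesis using assms by simp
qed

lemma multilinear_word_inner: "multilinear_words (word_inner v)"
proof (rule multilinear_wordsI)
  fix w :: "'a complexification list" and i x y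
  assume i: "i < length w"
  note upd = prod_list_update[OF i, where g = "\<lambda>j. cinner (v ! j)"]
  show "word_inner v (w[i := x + y]) = word_inner v (w[i := x]) + word_inner v (w[i := y])"
    unfolding word_inner_def length_list_update upd
    by (simp add: cinner_add_right distrib_right)
next
  fix w :: "'a complexification list" and i c x
  assume i: "i < length w"
  note upd = prod_list_update[OF i, where g = "\<lambda>j. cinner (v ! j)"]
  show "word_inner v (w[i := c *\<^sub>C x]) = c *\<^sub>C word_inner v (w[i := x])"
    unfolding word_inner_def length_list_update upd
    by (simp add: cinner_scaleC_right scaleC_complex_def mult.assoc)
qed

lemma word_inner_commute: "word_inner v w = cnj (word_inner w v)"
proof (cases "length v = length w")
  case True
  have "(\<Prod>i<length w. cinner (v ! i) (w ! i)) = (\<Prod>i<length w. cnj (cinner (w ! i) (v ! i)))"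
    by (intro prod.cong refl cinner_commute)
  with True show ?thesis by (simp add: word_inner_def)
qed (simp add: word_inner_def)

lemma free_extend_eqI:
  assumes "\<And>w. f w = g w + c *\<^sub>C h w"
  shows "free_extend f p = free_extend g p + c *\<^sub>C free_extend h p"
proof -
  have "Poly_Mapping.lookup p w *\<^sub>C f w = Poly_Mapping.lookup p w *\<^sub>C g w
      + c *\<^sub>C Poly_Mapping.lookup p w *\<^sub>C h w" for w
    unfolding assms by (simp only: scaleC_add_right scaleC_scaleC mult.commute)
  then show ?thesis
    unfolding free_extend_def by (simp only: sum.distrib scaleC_sum_right)
qed

lemma tensor_lift_eqI:
  assumes "multilinear_words f" "multilinear_words g" "multilinear_words h"
    and "\<And>w. f w = g w + c *\<^sub>C h w"
  shows "tensor_lift f \<xi> = tensor_lift g \<xi> + c *\<^sub>C tensor_lift h \<xi>"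
proof -
  note eq = free_extend_eqI[of f g c h, OF assms(4)]
  show ?thesis
    using assms(1-3) eq by (induct \<xi>) (simp add: tensor_lift.abs_eq)
qed

lemma multilinear_inner0: "multilinear_words (\<lambda>v. cnj (tensor_lift (word_inner v) \<eta>))"
proof (rule multilinear_wordsI)
  fix w :: "'a complexification list" and i x y
  assume i: "i < length w"
  have *: "word_inner (w[i := x + y]) v = word_inner (w[i := x]) v + 1 *\<^sub>C word_inner (w[i := y]) v" for v
    using multilinear_word_inner[of v] i
    unfolding multilinear_words_def scaleC_one by (subst (1 2 3) word_inner_commute) simp
  show "cnj (tensor_lift (word_inner (w[i := x + y])) \<eta>) =
      cnj (tensor_lift (word_inner (w[i := x])) \<eta>) + cnj (tensor_lift (word_inner (w[i := y])) \<eta>)"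
    by (subst tensor_lift_eqI[OF multilinear_word_inner multilinear_word_inner
          multilinear_word_inner *]) (simp add: scaleC_one)
next
  fix w :: "'a complexification list" and i c x
  assume i: "i < length w"
  have *: "word_inner (w[i := c *\<^sub>C x]) v = word_inner (w[i := x]) v + (cnj c - 1) *\<^sub>C word_inner (w[i := x]) v" for v
    using multilinear_word_inner[of v] i
    unfolding multilinear_words_def by (subst (1 2 3) word_inner_commute) (simp add: scaleC_complex_def algebra_simps)
  show "cnj (tensor_lift (word_inner (w[i := c *\<^sub>C x])) \<eta>) =
      c *\<^sub>C cnj (tensor_lift (word_inner (w[i := x])) \<eta>)"
    by (subst tensor_lift_eqI[OF multilinear_word_inner multilinear_word_inner
          multilinear_word_inner *]) (simp add: scaleC_complex_def algebra_simps)
qed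

lemma inner0_tensor: "inner0 (tensor v) (tensor w) = word_inner v w"
proof -
  have "inner0 (tensor v) (tensor w) = cnj (tensor_lift (word_inner w) (tensor v))"
    unfolding inner0_def by (rule tensor_lift_tensor[OF multilinear_inner0])
  also have "tensor_lift (word_inner w) (tensor v) = word_inner w v"
    by (rule tensor_lift_tensor[OF multilinear_word_inner])
  finally show ?thesis
    by (simp only: word_inner_commute[symmetric])
qed

lemma multilinear_U:
  assumes \<pi>: "\<pi> permutes {..<n}"
  shows "multilinear_words (\<lambda>w. if length w = n
    then tensor (permute_list \<pi> w) else 0 :: 'v::complex_vector tensor_algebra)"
proof -
  have *: "\<exists>j<n. \<forall>x. permute_list \<pi> (w[i := x]) = (permute_list \<pi> w)[j := x]"
    if "length w = n" "i < n" for w :: "'v list" and i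
  proof -
    obtain j where "\<pi> j = i"
      using permutes_surj[OF \<pi>] by (metis surjD)
    then have j: "j < n" "\<pi> j = i"
      using permutes_in_image[OF \<pi>, of j] that by auto
    moreover have inj: "\<pi> k = i \<longleftrightarrow> j = k" for k
      using j permutes_inj[OF \<pi>] by (auto dest: injD)
    moreover have "permute_list \<pi> (w[i := x]) = (permute_list \<pi> w)[j := x]" for x
    proof (rule nth_equalityI)
      fix k assume "k < length (permute_list \<pi> (w[i := x]))"
      then have k: "k < n" "\<pi> k < n"
        using permutes_in_image[OF \<pi>, of k] that by simp_all
      then show "permute_list \<pi> (w[i := x]) ! k = (permute_list \<pi> w)[j := x] ! k"
        using that \<pi> inj[of k] by (cases "j = k") (simp_all add: permute_list_nth)
    qed simp
    ultimately show ?thesis by blast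
  qed
  show ?thesis
  proof (rule multilinear_wordsI)
    fix w :: "'v list" and i x y assume "i < length w"
    then show "(if length (w[i := x + y]) = n then tensor (permute_list \<pi> (w[i := x + y])) else 0) =
      (if length (w[i := x]) = n then tensor (permute_list \<pi> (w[i := x])) else 0) +
      (if length (w[i := y]) = n then tensor (permute_list \<pi> (w[i := y])) else 0)"
      using *[of w i] by (auto simp: tensor_update_add)
  next
    fix w :: "'v list" and i c x assume "i < length w"
    then show "(if length (w[i := c *\<^sub>C x]) = n then tensor (permute_list \<pi> (w[i := c *\<^sub>C x])) else 0) =
      c *\<^sub>C (if length (w[i := x]) = n then tensor (permute_list \<pi> (w[i := x])) else 0)"
      using *[of w i] by (auto simp: tensor_update_scaleC)
  qed
qed

lemma U_perm_tensor:
  assumes "\<pi> permutes {..<n}" "length w = n"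
  shows "U_perm n \<pi> (tensor w) = tensor (permute_list \<pi> w)"
  unfolding U_perm_def tensor_lift_tensor[OF multilinear_U[OF assms(1)]] using assms(2) by simp

lemma U_perm_add: "U_perm n \<pi> (\<xi> + \<eta>) = U_perm n \<pi> \<xi> + U_perm n \<pi> \<eta>"
  and U_perm_scaleC: "U_perm n \<pi> (c *\<^sub>C \<xi>) = c *\<^sub>C U_perm n \<pi> \<xi>"
  using clinear_tensor_lift unfolding U_perm_def clinear_def by blast+

lemma P_level_add: "P_level q t n (\<xi> + \<eta>) = P_level q t n \<xi> + P_level q t n \<eta>"
  by (simp add: P_level_def U_perm_add scaleC_add_right sum.distrib)

lemma P_level_scaleC: "P_level q t n (c *\<^sub>C \<xi>) = c *\<^sub>C P_level q t n \<xi>"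
  by (simp add: P_level_def U_perm_scaleC scaleC_sum_right scaleC_scaleC mult.commute)

lemma P_qt_tensor: "P_qt q t (tensor w) = P_level q t (length w) (tensor w)"
  unfolding P_qt_def
  by (intro tensor_lift_tensor multilinear_wordsI)
    (simp_all add: tensor_update_add tensor_update_scaleC P_level_add P_level_scaleC)

lemma creation_tensor: "creation f (tensor w) = tensor (to_cplx f # w)"
  unfolding creation_def
proof (intro tensor_lift_tensor multilinear_wordsI)
  fix w :: "'a complexification list" and i x y assume "i < length w"
  then show "tensor (to_cplx f # w[i := x + y]) =
      tensor (to_cplx f # w[i := x]) + tensor (to_cplx f # w[i := y])"
    using tensor_update_add[of "Suc i" "to_cplx f # w"] by simp
next
  fix w :: "'a complexification list" and i c x assume "i < length w"
  then show "tensor (to_cplx f # w[i := c *\<^sub>C x]) = c *\<^sub>C tensor (to_cplx f # w[i := x])"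
    using tensor_update_scaleC[of "Suc i" "to_cplx f # w"] by simp
qed

lemma annihilation_tensor: "annihilation q t f (tensor w) = annihilation_word q t f w"
proof -
  have *: "\<exists>j<length w - 1. \<forall>x. take k (w[i := x]) @ drop (Suc k) (w[i := x])
      = (take k w @ drop (Suc k) w)[j := x]"
    if "i < length w" "k < length w" "i \<noteq> k" for w :: "'a complexification list" and i k
  proof (cases "i < k")
    case True
    with that show ?thesis
      by (intro exI[of _ i]) (auto simp: take_update_swap list_update_append)
  next
    case False
    with that have "k < i" by simp
    with that show ?thesis
      by (intro exI[of _ "i - 1"])
        (auto simp: take_update_swap list_update_append drop_update_swap list_update_beyond)
  qed
  show ?thesis
    unfolding annihilation_def
  proof (intro tensor_lift_tensor multilinear_wordsI)
    fix w :: "'a complexification list" and i x y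
    assume i: "i < length w"
    show "annihilation_word q t f (w[i := x + y]) =
        annihilation_word q t f (w[i := x]) + annihilation_word q t f (w[i := y])"
      unfolding annihilation_word_def length_list_update sum.distrib[symmetric]
    proof (intro sum.cong refl)
      fix k assume "k \<in> {..<length w}"
      then have k: "k < length w" by simp
      show "(complex_of_real (q ^ k * t ^ (length w - 1 - k)) * cinner (to_cplx f) (w[i := x + y] ! k)) *\<^sub>C
          tensor (take k (w[i := x + y]) @ drop (Suc k) (w[i := x + y])) =
        (complex_of_real (q ^ k * t ^ (length w - 1 - k)) * cinner (to_cplx f) (w[i := x] ! k)) *\<^sub>C
          tensor (take k (w[i := x]) @ drop (Suc k) (w[i := x])) +
        (complex_of_real (q ^ k * t ^ (length w - 1 - k)) * cinner (to_cplx f) (w[i := y] ! k)) *\<^sub>C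
          tensor (take k (w[i := y]) @ drop (Suc k) (w[i := y]))"
      proof (cases "i = k")
        case True
        then show ?thesis using k
          by (simp add: cinner_add_right distrib_left scaleC_add_left)
      next
        case False
        then obtain j where "j < length w - 1"
          "\<And>x. take k (w[i := x]) @ drop (Suc k) (w[i := x]) = (take k w @ drop (Suc k) w)[j := x]"
          using *[OF i k] by blast
        then show ?thesis using k False
          by (simp add: tensor_update_add scaleC_add_right)
      qed
    qed
  next
    fix w :: "'a complexification list" and i c x
    assume i: "i < length w"
    show "annihilation_word q t f (w[i := c *\<^sub>C x]) = c *\<^sub>C annihilation_word q t f (w[i := x])"
      unfolding annihilation_word_def length_list_update scaleC_sum_right
    proof (intro sum.cong refl)
      fix k assume "k \<in> {..<length w}"
      then have k: "k < length w" by simp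
      show "(complex_of_real (q ^ k * t ^ (length w - 1 - k)) * cinner (to_cplx f) (w[i := c *\<^sub>C x] ! k)) *\<^sub>C
          tensor (take k (w[i := c *\<^sub>C x]) @ drop (Suc k) (w[i := c *\<^sub>C x])) =
        c *\<^sub>C (complex_of_real (q ^ k * t ^ (length w - 1 - k)) * cinner (to_cplx f) (w[i := x] ! k)) *\<^sub>C
          tensor (take k (w[i := x]) @ drop (Suc k) (w[i := x]))"
      proof (cases "i = k")
        case True
        then show ?thesis using k
          by (simp add: cinner_scaleC_right scaleC_scaleC mult_ac)
      next
        case False
        then obtain j where "j < length w - 1"
          "\<And>x. take k (w[i := x]) @ drop (Suc k) (w[i := x]) = (take k w @ drop (Suc k) w)[j := x]"
          using *[OF i k] by blast
        then show ?thesis using k False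
          by (simp add: tensor_update_scaleC scaleC_scaleC mult_ac)
      qed
    qed
  qed
qed

section \<open>The completion and operators on it\<close>

text \<open>
  The \<open>(q,t)\<close>-Fock space is a completion of the algebraic Fock space: a complex Hilbert space
  with a linear map \<open>\<iota>\<close> onto a dense subspace that carries the \<open>(q,t)\<close>-inner product to the inner
  product of the Hilbert space.  This determines the pair up to a unique unitary isomorphism.
\<close>

definition fock_completion ::
    "real \<Rightarrow> real \<Rightarrow> ('a::real_inner fock \<Rightarrow> 'k::complex_hilbert) \<Rightarrow> bool" where
  "fock_completion q t \<iota> \<longleftrightarrow> clinear \<iota> \<and> closure (range \<iota>) = UNIV \<and>
     (\<forall>\<eta> \<xi>. cinner (\<iota> \<eta>) (\<iota> \<xi>) = inner_qt q t \<eta> \<xi>)"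

definition bounded_clinear :: "('k::complex_hilbert \<Rightarrow> 'k) \<Rightarrow> bool" where
  "bounded_clinear T \<longleftrightarrow> clinear T \<and> (\<exists>K. \<forall>x. norm (T x) \<le> K * norm x)"

definition is_adjoint :: "('k::complex_hilbert \<Rightarrow> 'k) \<Rightarrow> ('k \<Rightarrow> 'k) \<Rightarrow> bool" where
  "is_adjoint S T \<longleftrightarrow> (\<forall>x y. cinner (S x) y = cinner x (T y))"

text \<open>
  The bounded operator on the completion that extends an operator given on the algebraic Fock
  space; it is unique because the range of \<open>\<iota>\<close> is dense.
\<close>

definition bounded_extension ::
    "('a::real_inner fock \<Rightarrow> 'k::complex_hilbert) \<Rightarrow> ('a fock \<Rightarrow> 'a fock) \<Rightarrow> 'k \<Rightarrow> 'k" where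
  "bounded_extension \<iota> T = (THE S. bounded_clinear S \<and> (\<forall>\<xi>. S (\<iota> \<xi>) = \<iota> (T \<xi>)))"

definition s_qt ::
    "real \<Rightarrow> real \<Rightarrow> ('a::real_inner fock \<Rightarrow> 'k::complex_hilbert) \<Rightarrow> 'a \<Rightarrow> 'k \<Rightarrow> 'k" where
  "s_qt q t \<iota> h =
     (\<lambda>x. bounded_extension \<iota> (annihilation q t h) x + bounded_extension \<iota> (creation h) x)"

inductive_set star_algebra :: "('k::complex_hilbert \<Rightarrow> 'k) set \<Rightarrow> ('k \<Rightarrow> 'k) set"
  for G :: "('k \<Rightarrow> 'k) set" where
  generator: "T \<in> G \<Longrightarrow> T \<in> star_algebra G"
| one: "id \<in> star_algebra G"
| add: "S \<in> star_algebra G \<Longrightarrow> T \<in> star_algebra G \<Longrightarrow> (\<lambda>x. S x + T x) \<in> star_algebra G"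
| scale: "T \<in> star_algebra G \<Longrightarrow> (\<lambda>x. c *\<^sub>C T x) \<in> star_algebra G"
| mult: "S \<in> star_algebra G \<Longrightarrow> T \<in> star_algebra G \<Longrightarrow> S \<circ> T \<in> star_algebra G"
| adjoint: "T \<in> star_algebra G \<Longrightarrow> bounded_clinear S \<Longrightarrow> is_adjoint S T \<Longrightarrow> S \<in> star_algebra G"

text \<open>The coarsest topology on the bounded operators making all matrix coefficients continuous.\<close>

definition weak_operator_topology :: "('k::complex_hilbert \<Rightarrow> 'k) topology" where
  "weak_operator_topology =
     pullback_topology {T. bounded_clinear T} (\<lambda>T (x, y). cinner x (T y)) euclidean"

definition Gamma_qt ::
    "real \<Rightarrow> real \<Rightarrow> ('a::real_inner fock \<Rightarrow> 'k::complex_hilbert) \<Rightarrow> ('k \<Rightarrow> 'k) set" where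
  "Gamma_qt q t \<iota> = weak_operator_topology closure_of star_algebra (range (s_qt q t \<iota>))"

definition vacuum_state ::
    "('a::real_inner fock \<Rightarrow> 'k::complex_hilbert) \<Rightarrow> ('k \<Rightarrow> 'k) \<Rightarrow> complex" where
  "vacuum_state \<iota> b = cinner (\<iota> vacuum) (b (\<iota> vacuum))"

end

(* The operators s(h) act on words by explicit formulas. Expanding the deformed inner product along
   the value pi(0) gives the adjointness of creation and annihilation, and the relation
   a(f) a(f)^* = q a(f)^* a(f) + |f|^2 t^n on n particles then bounds them by induction on n.
   For t = 1, reversing words turns s(h) into an operator acting from the right, which commutes
   with all s(f) and agrees with s(h) at the vacuum; hence s(h) y and y s(h) have the same vacuum
   expectation.
   Conversely, for orthogonal x, y the vacuum moments of x x y y and x y y x are |x|^2 |y|^2 and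
   t |x|^2 |y|^2. *)

theory Submission
  imports Defs
begin

section \<open>Complex Hilbert spaces\<close>

text \<open>Appending a letter to a word multiplies every old coefficient of annihilation by one
  more factor t and leaves its power of q alone. With t = 1 this discrepancy is absent, and the
  commutator of left annihilation with right creation is q^n <f,h> on n particles. The commutator of
  right annihilation with left creation is its adjoint, hence the same scalar, and the two enter the
  commutator of the field operators with opposite signs. Right annihilation is used through its
  adjoint, right creation, so this cancellation is checked inside the inner product and stated after
  applying \<iota>. Positivity comes from the Hilbert space whose inner product \<iota> pulls back:
  Cauchy-Schwarz applies to algebraic vectors, and a vector orthogonal to itself has image 0.
  Multiplication is separately but not jointly continuous in the weak operator topology. The trace
  identity therefore passes to the closure one variable at a time, after it has spread from a single
  generator to the whole algebra by cyclic rotation.\<close>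

lemma clinear_0: "clinear f \<Longrightarrow> f 0 = 0"
  unfolding clinear_def by (metis scaleC_zero_left)

lemma clinear_add: "clinear f \<Longrightarrow> f (x + y) = f x + f y"
  and clinear_scaleC: "clinear f \<Longrightarrow> f (c *\<^sub>C x) = c *\<^sub>C f x"
  by (simp_all add: clinear_def)

lemma clinear_diff: "clinear f \<Longrightarrow> f (x - y) = f x - f y"
  using clinear_add[of f "x - y" y] by simp

lemma clinear_sum: "clinear f \<Longrightarrow> f (\<Sum>i\<in>I. g i) = (\<Sum>i\<in>I. f (g i))"
  by (induction I rule: infinite_finite_induct) (simp_all add: clinear_0 clinear_add)

lemma clinear_compose: "clinear f \<Longrightarrow> clinear g \<Longrightarrow> clinear (\<lambda>x. f (g x))"
  by (simp add: clinear_def)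

lemma clinear_plus: "clinear f \<Longrightarrow> clinear g \<Longrightarrow> clinear (\<lambda>x. f x + g x)"
  and clinear_scale: "clinear f \<Longrightarrow> clinear (\<lambda>x. c *\<^sub>C f x)"
  by (simp_all add: clinear_def scaleC_add_right scaleC_scaleC algebra_simps)

lemma cinner_add_left: "cinner (x + y) z = cinner x z + cinner y z"
  by (subst (1 2 3) cinner_commute) (simp add: cinner_add_right)

lemma cinner_scaleC_left: "cinner (c *\<^sub>C x) z = cnj c * cinner x z"
  by (subst (1 2) cinner_commute) (simp add: cinner_scaleC_right)

lemma clinear_cinner: "clinear (cinner x)"
  by (simp add: clinear_def cinner_add_right cinner_scaleC_right scaleC_complex_def)

lemma cinner_zero_left [simp]: "cinner 0 x = 0"
  using cinner_add_left[of 0 0 x] by simp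

lemma cinner_zero_right [simp]: "cinner x 0 = 0"
  using cinner_add_right[of x 0 0] by simp

lemma cinner_diff_right: "cinner x (y - z) = cinner x y - cinner x z"
  by (rule clinear_diff[OF clinear_cinner])

lemma cinner_diff_left: "cinner (x - y) z = cinner x z - cinner y z"
  by (subst (1 2 3) cinner_commute) (simp add: cinner_diff_right)

lemma cinner_sum_right: "cinner x (\<Sum>i\<in>I. f i) = (\<Sum>i\<in>I. cinner x (f i))"
  by (rule clinear_sum[OF clinear_cinner])

lemma cinner_sum_left: "cinner (\<Sum>i\<in>I. f i) x = (\<Sum>i\<in>I. cinner (f i) x)"
  by (subst (1 2) cinner_commute) (simp add: cinner_sum_right)

lemma Re_cinner_commute: "Re (cinner x y) = Re (cinner y x)"
  by (metis cinner_commute complex_cnj_cancel_iff complex_cnj_cnj cnj.simps(1))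

lemma norm_sq_cinner: "(norm (x :: 'k::complex_hilbert))\<^sup>2 = Re (cinner x x)"
  by (simp add: norm_eq_sqrt_cinner cinner_ge_zero)

lemma norm_scaleC: "norm (c *\<^sub>C (x :: 'k::complex_hilbert)) = cmod c * norm x"
proof -
  have "cinner (c *\<^sub>C x) (c *\<^sub>C x) = of_real ((cmod c)\<^sup>2) * cinner x x"
    by (simp add: cinner_scaleC_left cinner_scaleC_right complex_norm_square mult_ac del: of_real_power)
  then show ?thesis
    by (simp add: norm_eq_sqrt_cinner real_sqrt_mult)
qed

lemma norm_add_sq:
  "(norm (x + y))\<^sup>2 = (norm x)\<^sup>2 + 2 * Re (cinner x y) + (norm (y :: 'k::complex_hilbert))\<^sup>2"
  using Re_cinner_commute[of x y]
  by (simp add: norm_sq_cinner cinner_add_left cinner_add_right)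

lemma norm_diff_sq:
  "(norm (x - y))\<^sup>2 = (norm x)\<^sup>2 - 2 * Re (cinner x y) + (norm (y :: 'k::complex_hilbert))\<^sup>2"
  using Re_cinner_commute[of x y]
  by (simp add: norm_sq_cinner cinner_diff_left cinner_diff_right)

text \<open>The triangle inequality is already part of the class, and gives Cauchy--Schwarz.\<close>

lemma Re_cinner_le: "Re (cinner x y) \<le> norm x * norm (y :: 'k::complex_hilbert)"
proof -
  have "(norm (x + y))\<^sup>2 \<le> (norm x + norm y)\<^sup>2"
    by (simp add: norm_triangle_ineq power_mono)
  then show ?thesis
    by (simp add: norm_add_sq power2_sum)
qed

lemma norm_cinner_le: "cmod (cinner x y) \<le> norm x * norm (y :: 'k::complex_hilbert)"
proof (cases "cinner x y = 0")
  case False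
  define c where "c = cnj (sgn (cinner x y))"
  have c: "cmod c = 1" using False by (simp add: c_def norm_sgn)
  have "c * cinner x y = of_real (cmod (cinner x y))"
    using False
    by (simp add: c_def sgn_eq complex_norm_square[symmetric] mult.commute power2_eq_square)
  then have "cmod (cinner x y) = Re (cinner x (c *\<^sub>C y))"
    by (simp add: cinner_scaleC_right)
  also have "\<dots> \<le> norm x * norm (c *\<^sub>C y)" by (rule Re_cinner_le)
  finally show ?thesis by (simp add: norm_scaleC c)
qed simp

lemma bounded_linear_cinner: "bounded_linear (cinner (x :: 'k::complex_hilbert))"
proof (rule bounded_linear_intro[where K = "norm x"])
  show "norm (cinner x y) \<le> norm y * norm x" for y
    using norm_cinner_le[of x y] by (simp add: mult.commute)
qed (simp_all add: cinner_add_right scaleR_scaleC cinner_scaleC_right scaleR_conv_of_real)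

lemma bounded_linear_scaleC: "bounded_linear (scaleC c :: 'k::complex_hilbert \<Rightarrow> 'k)"
  by (rule bounded_linear_intro[where K = "cmod c"])
    (simp_all add: scaleC_add_right scaleR_scaleC scaleC_scaleC norm_scaleC mult.commute)

section \<open>Bounded complex-linear operators and vectors representing functionals\<close>

lemma bounded_clinear_clinear: "bounded_clinear T \<Longrightarrow> clinear T"
  by (simp add: bounded_clinear_def)

lemma bounded_clinear_bounded_linear:
  assumes "bounded_clinear T"
  shows "bounded_linear T"
proof -
  obtain K where K: "norm (T x) \<le> K * norm x" for x
    using assms by (auto simp: bounded_clinear_def)
  show ?thesis
    by (rule bounded_linear_intro[where K = K])
      (use bounded_clinear_clinear[OF assms] K
        in \<open>auto simp: clinear_add scaleR_scaleC clinear_scaleC mult.commute\<close>)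
qed

lemma bounded_clinear_compose:
  assumes "bounded_clinear S" "bounded_clinear T"
  shows "bounded_clinear (S \<circ> T)"
  using bounded_linear.bounded[OF bounded_linear_compose[OF assms[THEN bounded_clinear_bounded_linear]]]
    clinear_compose[OF assms[THEN bounded_clinear_clinear]]
  by (auto simp: bounded_clinear_def o_def mult.commute)

lemma bounded_clinear_add:
  assumes "bounded_clinear S" "bounded_clinear T"
  shows "bounded_clinear (\<lambda>x. S x + T x)"
  using bounded_linear.bounded[OF bounded_linear_add[OF assms[THEN bounded_clinear_bounded_linear]]]
    clinear_plus[OF assms[THEN bounded_clinear_clinear]]
  by (auto simp: bounded_clinear_def mult.commute)

lemma bounded_clinear_scaleC:
  assumes "bounded_clinear T"
  shows "bounded_clinear (\<lambda>x. c *\<^sub>C T x)"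
  using bounded_linear.bounded[OF bounded_linear_compose[OF bounded_linear_scaleC
        bounded_clinear_bounded_linear[OF assms], of c]]
    clinear_scale[OF bounded_clinear_clinear[OF assms]]
  by (auto simp: bounded_clinear_def mult.commute)

lemma bounded_clinear_id: "bounded_clinear id"
  by (auto simp: bounded_clinear_def clinear_def intro: exI[of _ 1])

text \<open>The representing vector is the minimiser of \<open>\<parallel>v\<parallel>\<^sup>2 / 2 - Re (\<phi> v)\<close>.\<close>

lemma riesz_representation:
  fixes \<phi> :: "'k::complex_hilbert \<Rightarrow> complex"
  assumes lin: "clinear \<phi>" and bound: "\<And>v. cmod (\<phi> v) \<le> K * norm v"
  obtains z where "\<And>v. \<phi> v = cinner z v"
proof -
  define F where "F v = (norm v)\<^sup>2 / 2 - Re (\<phi> v)" for v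
  have lower: "- K\<^sup>2 / 2 \<le> F v" for v
  proof -
    have "Re (\<phi> v) \<le> K * norm v" using bound[of v] complex_Re_le_cmod[of "\<phi> v"] by linarith
    moreover have "0 \<le> (norm v - K)\<^sup>2" by simp
    ultimately show ?thesis by (simp add: F_def power2_diff mult.commute)
  qed
  have real_lin: "\<phi> (r *\<^sub>R v) = of_real r * \<phi> v" for r v
    using lin by (simp add: scaleR_scaleC clinear_scaleC scaleC_complex_def)
  have bl: "bounded_linear \<phi>"
    by (rule bounded_linear_intro[where K = K])
      (use bound in \<open>auto simp: clinear_add[OF lin] real_lin scaleR_conv_of_real mult.commute\<close>)
  define m where "m = Inf (range F)"
  have bdd: "bdd_below (range F)" using lower by (auto simp: bdd_below_def)
  have m: "m \<le> F v" for v unfolding m_def by (rule cInf_lower[OF _ bdd]) simp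
  have "\<exists>v. F v < m + inverse (real (Suc n))" for n
    using cInf_lessD[of "range F" "m + inverse (real (Suc n))"] by (auto simp: m_def)
  then obtain v where v: "F (v n) < m + inverse (real (Suc n))" for n by metis
  \<comment> \<open>The parallelogram law, the linear parts cancelling: two points at which F is
    nearly minimal are close to each other, so a minimising sequence is Cauchy.\<close>
  have mid: "(norm (a - b))\<^sup>2 / 4 = F a + F b - 2 * F ((1/2) *\<^sub>R (a + b))" for a b
  proof -
    have "Re (\<phi> ((1/2) *\<^sub>R (a + b))) = (Re (\<phi> a) + Re (\<phi> b)) / 2"
      by (simp add: real_lin clinear_add[OF lin])
    moreover have "(norm ((1/2) *\<^sub>R (a + b)))\<^sup>2 = (norm (a + b))\<^sup>2 / 4"
      by (simp add: power_mult_distrib power_divide)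
    ultimately show ?thesis
      unfolding F_def by (simp add: norm_add_sq norm_diff_sq)
  qed
  have close: "(norm (v i - v j))\<^sup>2 \<le> 4 * (inverse (real (Suc i)) + inverse (real (Suc j)))" for i j
  proof -
    define d where "d k = inverse (real (Suc k))" for k
    show ?thesis
      using mid[of "v i" "v j"] m[of "(1/2) *\<^sub>R (v i + v j)"] v[of i] v[of j]
      unfolding d_def[symmetric] by argo
  qed
  have "Cauchy v"
  proof (rule CauchyI)
    fix e :: real assume "0 < e"
    then obtain N where N: "inverse (real (Suc N)) < e\<^sup>2 / 8"
      using reals_Archimedean[of "e\<^sup>2 / 8"] by auto
    have "norm (v i - v j) < e" if "N \<le> i" "N \<le> j" for i j
    proof -
      have "inverse (real (Suc k)) \<le> inverse (real (Suc N))" if "N \<le> k" for k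
        using that by (intro le_imp_inverse_le) auto
      from this[OF that(1)] this[OF that(2)] have "(norm (v i - v j))\<^sup>2 < e\<^sup>2"
        using close[of i j] N by argo
      then show ?thesis using \<open>0 < e\<close> by (simp add: power2_less_imp_less)
    qed
    then show "\<exists>N. \<forall>i\<ge>N. \<forall>j\<ge>N. norm (v i - v j) < e" by blast
  qed
  then obtain z where z: "v \<longlonglongrightarrow> z" using Cauchy_convergent convergent_def by blast
  have "(\<lambda>n. F (v n)) \<longlonglongrightarrow> F z"
    unfolding F_def by (intro tendsto_intros z bounded_linear.tendsto[OF bl]) simp
  moreover have "(\<lambda>n. m + inverse (real (Suc n))) \<longlonglongrightarrow> m + 0"
    by (intro tendsto_intros LIMSEQ_inverse_real_of_nat)
  ultimately have "F z \<le> m"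
    using v by (intro LIMSEQ_le[of "\<lambda>n. F (v n)" _ "\<lambda>n. m + inverse (real (Suc n))"])
      (auto intro!: exI[of _ 0] less_imp_le)
  then have min: "F z \<le> F w" for w using m[of w] by linarith
  have Re_eq: "Re (\<phi> w) = Re (cinner z w)" for w
  proof (rule ccontr)
    assume ne: "Re (\<phi> w) \<noteq> Re (cinner z w)"
    define d where "d = Re (\<phi> w) - Re (cinner z w)"
    \<comment> \<open>The extra 1 keeps W positive when w = 0. Moving from z by (d / W) w would
      lower F strictly, because the quadratic cost is less than half of the linear gain d^2 /
      W.\<close>
    define W where "W = (norm w)\<^sup>2 + 1"
    have W: "W > 0" by (simp add: W_def add_nonneg_pos)
    have "d \<noteq> 0" using ne by (simp add: d_def)
    have F_line: "F (z + r *\<^sub>R w) = F z - r * d + r\<^sup>2 * (norm w)\<^sup>2 / 2" for r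
      unfolding F_def norm_add_sq clinear_add[OF lin] real_lin d_def
      by (simp add: scaleR_scaleC cinner_scaleC_right norm_scaleC power_mult_distrib field_simps)
    have "r * d \<le> r\<^sup>2 * (norm w)\<^sup>2 / 2" for r
      using F_line[of r] min[of "z + r *\<^sub>R w"] by linarith
    from this[of "d / W"] have "d\<^sup>2 / W \<le> d\<^sup>2 / W * ((norm w)\<^sup>2 / W / 2)"
      by (simp add: power2_eq_square field_simps)
    moreover have "(norm w)\<^sup>2 / W / 2 < 1" using W by (simp add: W_def field_simps)
    moreover have "d\<^sup>2 / W > 0" using \<open>d \<noteq> 0\<close> W by simp
    ultimately show False
      using mult_strict_left_mono[of "(norm w)\<^sup>2 / W / 2" 1 "d\<^sup>2 / W"] by linarith
  qed
  have "\<phi> w = cinner z w" for w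
  proof (rule complex_eqI)
    \<comment> \<open>Multiplication by \<i> turns the statement on real parts into the one on
      imaginary parts.\<close>
    have "Re (\<i> * \<phi> w) = Re (\<i> * cinner z w)"
      using Re_eq[of "\<i> *\<^sub>C w"]
      by (simp only: clinear_scaleC[OF lin] cinner_scaleC_right scaleC_complex_def)
    then show "Im (\<phi> w) = Im (cinner z w)" by simp
  qed (rule Re_eq)
  then show ?thesis by (rule that)
qed

text \<open>The vector z is the adjoint of T applied to u. It absorbs the outer operator of a
  product into a fixed vector.\<close>

lemma bounded_clinear_cinner_representation:
  assumes "bounded_clinear T"
  obtains z where "\<And>v. cinner u (T v) = cinner z v"
proof -
  have "bounded_linear (\<lambda>v. cinner u (T v))"
    by (rule bounded_linear_compose[OF bounded_linear_cinner bounded_clinear_bounded_linear[OF assms]])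
  then obtain K where "\<And>v. cmod (cinner u (T v)) \<le> K * norm v"
    using bounded_linear.bounded[of "\<lambda>v. cinner u (T v)"] by (auto simp: mult.commute)
  with clinear_compose[OF clinear_cinner bounded_clinear_clinear[OF assms]] show ?thesis
    by (rule riesz_representation) (rule that)
qed

lemma is_adjoint_sym: "is_adjoint S T \<Longrightarrow> is_adjoint T S"
  unfolding is_adjoint_def by (metis cinner_commute)

section \<open>The weak operator topology\<close>

lemma topspace_weak_operator_topology [simp]:
  "topspace weak_operator_topology = {T. bounded_clinear T}"
  by (simp add: weak_operator_topology_def topspace_pullback_topology)

lemma continuous_map_weak_operator_topology:
  "continuous_map weak_operator_topology euclidean (\<lambda>T. cinner x (T y))"
proof -
  have "continuous_map euclidean euclidean (\<lambda>F :: 'a \<times> 'a \<Rightarrow> complex. F (x, y))"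
    by (simp add: continuous_on_product_coordinates)
  from continuous_map_pullback[OF this, of "{T. bounded_clinear T}" "\<lambda>T (x, y). cinner x (T y)"]
  show ?thesis by (simp add: weak_operator_topology_def o_def)
qed

text \<open>Both sides are matrix coefficients of the same operator T, hence continuous in it, and
  the set where they agree is closed.\<close>

lemma weak_closure_cinner_eq:
  assumes "T \<in> weak_operator_topology closure_of \<A>"
    and "\<And>T. T \<in> \<A> \<Longrightarrow> cinner a (T b) = cinner c (T d)"
  shows "cinner a (T b) = cinner c (T d)"
  by (rule forall_in_closure_of_eq[OF assms(1), of euclidean "\<lambda>T. cinner a (T b)"])
    (use assms(2) in \<open>auto simp: Hausdorff_space_euclidean continuous_map_weak_operator_topology\<close>)

lemma star_algebra_bounded_clinear:
  assumes "\<And>T. T \<in> G \<Longrightarrow> bounded_clinear T" "T \<in> star_algebra G"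
  shows "bounded_clinear T"
  using assms(2)
  by induction (simp_all only: assms(1) bounded_clinear_id bounded_clinear_add bounded_clinear_scaleC
      bounded_clinear_compose)

text \<open>The rule \<open>adjoint\<close> accepts an adjoint but does not provide one.
  Self-adjoint generators start the induction, and the adjoint of a composite is assembled from
  those of its parts.\<close>

lemma star_algebra_adjoint:
  assumes "\<And>T. T \<in> G \<Longrightarrow> bounded_clinear T \<and> is_adjoint T T" "T \<in> star_algebra G"
  shows "\<exists>S\<in>star_algebra G. is_adjoint S T"
  using assms(2)
proof induction
  case (generator T)
  then show ?case using assms(1) star_algebra.generator by blast
next
  case one
  have "is_adjoint id id" by (simp add: is_adjoint_def)
  then show ?case using star_algebra.one by blast
next
  case (add S T)
  then obtain S' T' where "S' \<in> star_algebra G" "is_adjoint S' S" "T' \<in> star_algebra G" "is_adjoint T' T"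
    by blast
  then show ?case
    by (intro bexI[of _ "\<lambda>x. S' x + T' x"] star_algebra.add)
      (auto simp: is_adjoint_def cinner_add_left cinner_add_right)
next
  case (scale T c)
  then obtain T' where "T' \<in> star_algebra G" "is_adjoint T' T" by blast
  then show ?case
    by (intro bexI[of _ "\<lambda>x. cnj c *\<^sub>C T' x"] star_algebra.scale)
      (auto simp: is_adjoint_def cinner_scaleC_left cinner_scaleC_right)
next
  case (mult S T)
  then obtain S' T' where "S' \<in> star_algebra G" "is_adjoint S' S" "T' \<in> star_algebra G" "is_adjoint T' T"
    by blast
  then show ?case
    by (intro bexI[of _ "T' \<circ> S'"] star_algebra.mult) (auto simp: is_adjoint_def)
next
  case (adjoint T S)
  then show ?case using is_adjoint_sym by blast
qed

text \<open>The commutant of R is closed under sums, multiples and products. Self-adjointness of R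
  makes it closed under adjoints as well, since R can then be moved across the inner product
  together with T.\<close>

lemma star_algebra_commute:
  assumes G: "\<And>T x. T \<in> G \<Longrightarrow> T (R x) = R (T x)"
    and R: "bounded_clinear R" "is_adjoint R R"
    and T: "T \<in> star_algebra G"
  shows "T (R x) = R (T x)"
  using T
proof (induction arbitrary: x)
  case (adjoint T S)
  have "cinner (S (R x) - R (S x)) y = 0" for y
  proof -
    have "cinner (S (R x)) y = cinner x (R (T y))"
      using adjoint R(2) by (simp add: is_adjoint_def)
    also have "\<dots> = cinner (R (S x)) y"
      unfolding adjoint.IH[symmetric] using adjoint R(2) by (simp add: is_adjoint_def)
    finally show ?thesis by (simp add: cinner_diff_left)
  qed
  then show ?case by (metis cinner_eq_zero_iff eq_iff_diff_eq_0)
qed (use G bounded_clinear_clinear[OF R(1)] in \<open>auto simp: clinear_add clinear_scaleC\<close>)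

text \<open>Riesz rewrites \<open>\<langle>\<Omega>, x v\<rangle>\<close> as \<open>\<langle>z, v\<rangle>\<close>, so that \<open>\<langle>\<Omega>, x y \<Omega>\<rangle>\<close> is weakly continuous in \<open>y\<close> too.\<close>

lemma vector_state_tracial:
  fixes \<Omega> :: "'k::complex_hilbert"
  assumes G: "\<And>T. T \<in> G \<Longrightarrow> bounded_clinear T \<and> is_adjoint T T"
    and trace: "\<And>g y. g \<in> G \<Longrightarrow> y \<in> star_algebra G \<Longrightarrow> cinner \<Omega> (g (y \<Omega>)) = cinner \<Omega> (y (g \<Omega>))"
    and x: "x \<in> weak_operator_topology closure_of star_algebra G"
    and y: "y \<in> weak_operator_topology closure_of star_algebra G"
  shows "cinner \<Omega> (x (y \<Omega>)) = cinner \<Omega> (y (x \<Omega>))"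
proof -
  have alg: "cinner \<Omega> (x (y \<Omega>)) = cinner \<Omega> (y (x \<Omega>))"
    if "x \<in> star_algebra G" "y \<in> star_algebra G" for x y
    using that
  proof (induction arbitrary: y)
    case (add S T)
    have "clinear y" using star_algebra_bounded_clinear[of G y] G add.prems bounded_clinear_clinear by blast
    then show ?case using add by (simp add: cinner_add_right clinear_add)
  next
    case (scale T c)
    have "clinear y" using star_algebra_bounded_clinear[of G y] G scale.prems bounded_clinear_clinear by blast
    then show ?case using scale by (simp add: cinner_scaleC_right clinear_scaleC)
  next
    case (mult S T)
    \<comment> \<open>Cyclic rotation: S is moved past the product of T and y, then T past the
      product of y and S. This is why y is arbitrary in the induction.\<close>
    show ?case
      using mult.IH(1)[OF star_algebra.mult[OF mult.hyps(2) mult.prems]]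
        mult.IH(2)[OF star_algebra.mult[OF mult.prems mult.hyps(1)]]
      by simp
  next
    case (adjoint T S)
    \<comment> \<open>The induction hypothesis concerns T, of which S is the adjoint. It is applied
      to T and the adjoint of y, and the resulting identity is conjugated.\<close>
    obtain y' where y': "y' \<in> star_algebra G" "is_adjoint y' y"
      using star_algebra_adjoint[of G y] G adjoint.prems by blast
    have "cinner \<Omega> (S (y \<Omega>)) = cinner (y' (T \<Omega>)) \<Omega>"
      using adjoint(3) y'(2) is_adjoint_sym unfolding is_adjoint_def by metis
    also have "\<dots> = cinner (T (y' \<Omega>)) \<Omega>"
      using adjoint.IH[OF y'(1)] by (metis cinner_commute)
    also have "\<dots> = cinner \<Omega> (y (S \<Omega>))"
      using adjoint(3) y'(2) is_adjoint_sym unfolding is_adjoint_def by metis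
    finally show ?case .
  qed (use trace in auto)
  have bounded: "bounded_clinear T" if "T \<in> weak_operator_topology closure_of star_algebra G" for T
    using that closure_of_subset_topspace[of weak_operator_topology] by auto
  \<comment> \<open>The first of the two passages to the closure: x is a limit while y is still
    algebraic. With z the adjoint of y at the vacuum, both sides are matrix coefficients of
    x.\<close>
  have half: "cinner \<Omega> (x (y \<Omega>)) = cinner \<Omega> (y (x \<Omega>))" if "y \<in> star_algebra G" for y
  proof -
    have "bounded_clinear y" using star_algebra_bounded_clinear[of G y] G that by blast
    then obtain z where z: "\<And>v. cinner \<Omega> (y v) = cinner z v"
      by (rule bounded_clinear_cinner_representation[where u = \<Omega>]) (rule that)
    show ?thesis
      unfolding z by (rule weak_closure_cinner_eq[OF x]) (rule alg[OF _ that, unfolded z])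
  qed
  obtain z where z: "\<And>v. cinner \<Omega> (x v) = cinner z v"
    by (rule bounded_clinear_cinner_representation[OF bounded[OF x]]) (rule that)
  show ?thesis
    unfolding z by (rule weak_closure_cinner_eq[OF y]) (rule half[unfolded z])
qed

section \<open>The algebraic Fock space\<close>

lemma abs_tensor_algebra_add:
  "abs_tensor_algebra (p + r) = abs_tensor_algebra p + abs_tensor_algebra r"
  by (simp add: plus_tensor_algebra.abs_eq)

lemma abs_tensor_algebra_single:
  "abs_tensor_algebra (Poly_Mapping.single w c) = c *\<^sub>C tensor w"
  by (simp add: tensor.abs_eq scaleC_tensor_algebra.abs_eq free_scale_simps)

text \<open>Every class has a finitely supported representative, which is built up one word at a
  time. Each new word lies outside the support so far, so updating amounts to adding a multiple of
  an elementary tensor.\<close>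

lemma tensor_algebra_induct [case_names zero add]:
  assumes "P 0" and add: "\<And>\<xi> c w. P \<xi> \<Longrightarrow> P (\<xi> + c *\<^sub>C tensor w)"
  shows "P \<xi>"
proof -
  have "P (abs_tensor_algebra p)" for p
  proof (induction p rule: update_induct)
    case const
    then show ?case by (simp add: assms(1) zero_tensor_algebra.abs_eq[symmetric])
  next
    case (update p w c)
    have "Poly_Mapping.update w c p = p + Poly_Mapping.single w c"
      using update(1) by (auto intro!: poly_mapping_eqI
          simp: lookup_update lookup_add lookup_single when_def in_keys_iff)
    then show ?case
      using update(3) by (simp add: abs_tensor_algebra_add abs_tensor_algebra_single add)
  qed
  moreover obtain p where "\<xi> = abs_tensor_algebra p"
    by (metis Quotient3_abs_rep Quotient3_tensor_algebra)
  ultimately show ?thesis by simp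
qed

lemma clinear_tensor_eqI:
  assumes "clinear f" "clinear g" "\<And>w. f (tensor w) = g (tensor w)"
  shows "f \<xi> = g \<xi>"
  by (induction \<xi> rule: tensor_algebra_induct)
    (simp_all add: assms clinear_0 clinear_add clinear_scaleC)

lemma clinear_creation: "clinear (creation f)"
  and clinear_annihilation: "clinear (annihilation q t f)"
  by (simp_all add: creation_def annihilation_def clinear_tensor_lift)

lemma annihilation_tensor_sum:
  "annihilation q t f (tensor w) = (\<Sum>k<length w.
     (complex_of_real (q ^ k * t ^ (length w - 1 - k)) * cinner (to_cplx f) (w ! k)) *\<^sub>C
       tensor (take k w @ drop (Suc k) w))"
  by (simp add: annihilation_tensor annihilation_word_def)

definition reversal :: "'a::real_inner fock \<Rightarrow> 'a fock" where
  "reversal = tensor_lift (\<lambda>w. tensor (rev w))"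

lemma clinear_reversal: "clinear reversal"
  by (simp add: reversal_def clinear_tensor_lift)

lemma reversal_tensor [simp]: "reversal (tensor w) = tensor (rev w)"
  unfolding reversal_def
  by (intro tensor_lift_tensor multilinear_wordsI)
    (simp_all add: rev_update tensor_update_add tensor_update_scaleC)

lemma reversal_reversal [simp]: "reversal (reversal \<xi>) = \<xi>"
  by (rule clinear_tensor_eqI[where f = "\<lambda>\<xi>. reversal (reversal \<xi>)"])
    (simp_all add: clinear_compose[OF clinear_reversal clinear_reversal], simp add: clinear_def)

text \<open>The projection onto the n-th tensor power. The commutation relation has the constant
  t^n, which depends on the particle number, so norms are estimated on each power
  separately.\<close>

definition particle_part :: "nat \<Rightarrow> 'a::real_inner fock \<Rightarrow> 'a fock" where
  "particle_part n = tensor_lift (\<lambda>w. if length w = n then tensor w else 0)"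

lemma clinear_particle_part: "clinear (particle_part n)"
  by (simp add: particle_part_def clinear_tensor_lift)

lemma particle_part_tensor: "particle_part n (tensor w) = (if length w = n then tensor w else 0)"
  unfolding particle_part_def
  by (intro tensor_lift_tensor multilinear_wordsI)
    (simp_all add: tensor_update_add tensor_update_scaleC)

text \<open>Claimed for all large cutoffs, so that in the induction the cutoffs of the old vector
  and of the new word can be replaced by a common one.\<close>

lemma sum_particle_part: "\<exists>N. \<forall>M\<ge>N. (\<Sum>n<M. particle_part n \<xi>) = \<xi>"
proof (induction \<xi> rule: tensor_algebra_induct)
  case zero
  then show ?case by (simp add: clinear_0[OF clinear_particle_part])
next
  case (add \<xi> c w)
  then obtain N where N: "(\<Sum>n<M. particle_part n \<xi>) = \<xi>" if "M \<ge> N" for M by blast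
  have "(\<Sum>n<M. particle_part n (\<xi> + c *\<^sub>C tensor w)) = \<xi> + c *\<^sub>C tensor w"
    if "M \<ge> max N (Suc (length w))" for M
  proof -
    have "(\<Sum>n<M. particle_part n (tensor w)) = tensor w"
      unfolding particle_part_tensor using that by (subst sum.delta') auto
    then show ?thesis
      using N[of M] that
      by (simp add: clinear_add[OF clinear_particle_part] clinear_scaleC[OF clinear_particle_part]
          sum.distrib scaleC_sum_right[symmetric])
  qed
  then show ?case by blast
qed

lemma creation_particle_part: "creation f (particle_part n \<xi>) = particle_part (Suc n) (creation f \<xi>)"
  by (rule clinear_tensor_eqI[where \<xi> = \<xi>])
    (auto intro: clinear_compose clinear_creation clinear_particle_part
      simp: particle_part_tensor creation_tensor clinear_0[OF clinear_creation])

lemma annihilation_particle_part_Suc: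
  "annihilation q t f (particle_part (Suc n) \<xi>) = particle_part n (annihilation q t f \<xi>)"
proof (rule clinear_tensor_eqI[where \<xi> = \<xi>])
  fix w
  show "annihilation q t f (particle_part (Suc n) (tensor w)) =
      particle_part n (annihilation q t f (tensor w))"
    by (cases "length w = Suc n")
      (auto simp: particle_part_tensor annihilation_tensor_sum clinear_sum[OF clinear_particle_part]
        clinear_scaleC[OF clinear_particle_part] clinear_0[OF clinear_annihilation]
        simp del: sum.lessThan_Suc intro!: sum.cong sum.neutral)
qed (auto intro: clinear_compose clinear_annihilation clinear_particle_part)

lemma annihilation_particle_part_0: "annihilation q t f (particle_part 0 \<xi>) = 0"
proof (rule clinear_tensor_eqI[where \<xi> = \<xi> and g = "\<lambda>_. 0"])
  show "annihilation q t f (particle_part 0 (tensor w)) = 0" for w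
    by (simp add: particle_part_tensor annihilation_tensor_sum clinear_0[OF clinear_annihilation])
qed (rule clinear_compose[OF clinear_annihilation clinear_particle_part], simp add: clinear_def)

lemma cinner_to_cplx: "cinner (to_cplx f) (to_cplx h) = complex_of_real (f \<bullet> h)"
  by (simp add: to_cplx_def cinner_complexification_def complex_of_real_def)

text \<open>The new first letter has n letters behind it and gives the term with t^n. Every other
  letter moves one place to the right with as many letters behind it as before, which costs one
  factor q.\<close>

lemma annihilation_creation_tensor:
  "annihilation q t f (creation h (tensor w)) =
     of_real q *\<^sub>C creation h (annihilation q t f (tensor w)) + of_real (t ^ length w * (f \<bullet> h)) *\<^sub>C tensor w"
  unfolding creation_tensor annihilation_tensor_sum
  by (simp add: sum.lessThan_Suc_shift clinear_sum[OF clinear_creation] scaleC_sum_right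
      clinear_scaleC[OF clinear_creation] creation_tensor scaleC_scaleC cinner_to_cplx
      add.commute mult_ac del: sum.lessThan_Suc)

lemma annihilation_creation_particle_part:
  "annihilation q t f (creation h (particle_part n \<xi>)) =
     of_real q *\<^sub>C creation h (annihilation q t f (particle_part n \<xi>)) +
     of_real (t ^ n * (f \<bullet> h)) *\<^sub>C particle_part n \<xi>"
proof (rule clinear_tensor_eqI[where \<xi> = \<xi>])
  show "annihilation q t f (creation h (particle_part n (tensor w))) =
     of_real q *\<^sub>C creation h (annihilation q t f (particle_part n (tensor w))) +
     of_real (t ^ n * (f \<bullet> h)) *\<^sub>C particle_part n (tensor w)" for w
    by (cases "length w = n")
      (simp_all add: particle_part_tensor annihilation_creation_tensor
        clinear_0[OF clinear_annihilation] clinear_0[OF clinear_creation])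
qed (rule clinear_compose[OF clinear_annihilation clinear_compose[OF clinear_creation clinear_particle_part]],
    rule clinear_plus[OF clinear_scale[OF clinear_compose[OF clinear_creation
      clinear_compose[OF clinear_annihilation clinear_particle_part]]] clinear_scale[OF clinear_particle_part]])

section \<open>The deformed inner product of words\<close>

definition word_qt ::
    "real \<Rightarrow> real \<Rightarrow> 'a::real_inner complexification list \<Rightarrow> 'a complexification list \<Rightarrow> complex" where
  "word_qt q t v w = (\<Sum>\<pi> | \<pi> permutes {..<length w}.
     of_real (q ^ inv_num (length w) \<pi> * t ^ cinv_num (length w) \<pi>) * word_inner v (permute_list \<pi> w))"

lemma inner_qt_tensor: "inner_qt q t (tensor v) (tensor w) = word_qt q t v w"
proof -
  have lin: "clinear (inner0 \<eta>)" for \<eta> :: "'a fock"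
    unfolding inner0_def by (rule clinear_tensor_lift)
  show ?thesis
    unfolding inner_qt_def P_qt_tensor P_level_def word_qt_def clinear_sum[OF lin] clinear_scaleC[OF lin]
    by (intro sum.cong) (simp_all add: U_perm_tensor inner0_tensor scaleC_complex_def)
qed

lemma word_qt_length: "length v \<noteq> length w \<Longrightarrow> word_qt q t v w = 0"
  by (simp add: word_qt_def word_inner_def)

section \<open>Expansion of the deformed inner product along the first letter\<close>

lemma word_inner_Cons: "word_inner (x # v) (y # w) = cinner x y * word_inner v w"
  by (simp add: word_inner_def prod.lessThan_Suc_shift del: prod.lessThan_Suc)

text \<open>The increasing enumeration of the natural numbers other than k.\<close>

definition skip :: "nat \<Rightarrow> nat \<Rightarrow> nat" where
  "skip k j = (if j < k then j else Suc j)"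

lemma skip_less_iff [simp]: "skip k i < skip k j \<longleftrightarrow> i < j"
  and skip_eq_iff [simp]: "skip k i = skip k j \<longleftrightarrow> i = j"
  and skip_neq [simp]: "skip k i \<noteq> k" "k \<noteq> skip k i"
  and skip_less: "skip k i < k \<longleftrightarrow> i < k" "k < skip k i \<longleftrightarrow> k \<le> i"
  by (auto simp: skip_def)

text \<open>The permutation \<open>\<pi>\<close> of \<open>{..n}\<close> with \<open>\<pi> 0 = k\<close> whose remaining values are ordered as by \<open>\<sigma>\<close>.\<close>

definition cons_perm :: "nat \<Rightarrow> (nat \<Rightarrow> nat) \<Rightarrow> nat \<Rightarrow> nat" where
  "cons_perm k \<sigma> i = (case i of 0 \<Rightarrow> k | Suc j \<Rightarrow> skip k (\<sigma> j))"

lemma cons_perm_simps [simp]: "cons_perm k \<sigma> 0 = k" "cons_perm k \<sigma> (Suc j) = skip k (\<sigma> j)"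
  by (simp_all add: cons_perm_def)

lemma cons_perm_permutes:
  assumes \<sigma>: "\<sigma> permutes {..<n}" and k: "k \<le> n"
  shows "cons_perm k \<sigma> permutes {..<Suc n}"
proof (rule bij_imp_permutes)
  have "inj_on (cons_perm k \<sigma>) {..<Suc n}"
  proof (rule inj_onI)
    fix i j assume "cons_perm k \<sigma> i = cons_perm k \<sigma> j"
    then show "i = j"
      using permutes_inj[OF \<sigma>] by (cases i; cases j) (auto dest: injD)
  qed
  moreover have "cons_perm k \<sigma> i < Suc n" if "i < Suc n" for i
  proof (cases i)
    case (Suc j)
    then have "\<sigma> j < n" using permutes_in_image[OF \<sigma>, of j] that by simp
    then show ?thesis using Suc by (simp add: skip_def)
  qed (use k in simp)
  ultimately show "bij_betw (cons_perm k \<sigma>) {..<Suc n} {..<Suc n}"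
    unfolding bij_betw_def by (intro conjI endo_inj_surj image_subsetI) simp_all
  show "cons_perm k \<sigma> i = i" if "i \<notin> {..<Suc n}" for i
  proof (cases i)
    case (Suc j)
    then have "\<sigma> j = j" using permutes_not_in[OF \<sigma>, of j] that by simp
    then show ?thesis using Suc that k by (simp add: skip_def)
  qed (use that in simp)
qed

text \<open>Injectivity is read off from the values; surjectivity follows by counting, both sides
  having (n+1)! elements.\<close>

lemma bij_betw_cons_perm:
  "bij_betw (\<lambda>(k, \<sigma>). cons_perm k \<sigma>) ({..<Suc n} \<times> {\<sigma>. \<sigma> permutes {..<n}}) {\<pi>. \<pi> permutes {..<Suc n}}"
  (is "bij_betw ?f ?A ?B")
proof -
  have inj: "inj_on ?f ?A"
  proof (intro inj_onI, clarify)
    fix k \<sigma> l \<tau> assume eq: "cons_perm k \<sigma> = cons_perm l \<tau>"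
    have k: "k = l" using fun_cong[OF eq, of 0] by simp
    have "\<sigma> j = \<tau> j" for j using fun_cong[OF eq, of "Suc j"] by (simp add: k)
    with k show "k = l \<and> \<sigma> = \<tau>" by blast
  qed
  have "card (?f ` ?A) = card ?B"
    unfolding card_image[OF inj] by (simp add: card_cartesian_product card_permutations[OF refl])
  moreover have "?f ` ?A \<subseteq> ?B" by (auto intro: cons_perm_permutes)
  ultimately have "?f ` ?A = ?B" by (intro card_subset_eq) (simp_all add: finite_permutations)
  with inj show ?thesis by (simp add: bij_betw_def)
qed

lemma card_permutes_Collect:
  assumes "\<sigma> permutes {..<n}"
  shows "card {j. j < n \<and> P (\<sigma> j)} = card {j. j < n \<and> P j}"
proof -
  have "\<sigma> ` {j. j < n \<and> P (\<sigma> j)} = {j. j < n \<and> P j}"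
  proof (intro equalityI subsetI)
    fix j assume "j \<in> {j. j < n \<and> P j}"
    then show "j \<in> \<sigma> ` {j. j < n \<and> P (\<sigma> j)}"
      using permutes_inverses(1)[OF assms] permutes_in_image[OF permutes_inv[OF assms], of j]
      by (intro image_eqI[of _ _ "inv \<sigma> j"]) auto
  qed (use permutes_in_image[OF assms] in auto)
  then show ?thesis
    using card_image[OF inj_on_subset[OF permutes_inj[OF assms]]] by (metis subset_UNIV)
qed

lemma card_first_coordinate_split:
  "card {(i, j). i < j \<and> j < Suc n \<and> R i j} =
     card {j. j < n \<and> R 0 (Suc j)} + card {(i, j). i < j \<and> j < n \<and> R (Suc i) (Suc j)}"
proof -
  let ?A = "{j. j < n \<and> R 0 (Suc j)}" and ?B = "{(i, j). i < j \<and> j < n \<and> R (Suc i) (Suc j)}"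
  have "{(i, j). i < j \<and> j < Suc n \<and> R i j} = (\<lambda>j. (0, Suc j)) ` ?A \<union> map_prod Suc Suc ` ?B"
  proof (intro equalityI subsetI)
    fix p assume "p \<in> {(i, j). i < j \<and> j < Suc n \<and> R i j}"
    then obtain i j where p: "p = (i, Suc j)" "i < Suc j" "j < n" "R i (Suc j)"
      by (auto elim: lessE)
    then show "p \<in> (\<lambda>j. (0, Suc j)) ` ?A \<union> map_prod Suc Suc ` ?B"
      by (cases i) force+
  qed auto
  moreover have "finite ?B" by (rule finite_subset[of _ "{..<n} \<times> {..<n}"]) auto
  ultimately show ?thesis
    by (simp only:) (subst card_Un_disjoint; force simp: card_image inj_on_def)
qed

text \<open>Of the n values after the first, k lie below k and n - k above it, whatever their order;
  these are the pairs containing position 0. The remaining pairs compare as under \<sigma>, since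
  \<open>skip k\<close> is increasing.\<close>

lemma inv_num_cons_perm:
  assumes "\<sigma> permutes {..<n}" "k \<le> n"
  shows "inv_num (Suc n) (cons_perm k \<sigma>) = k + inv_num n \<sigma>"
    and "cinv_num (Suc n) (cons_perm k \<sigma>) = n - k + cinv_num n \<sigma>"
proof -
  have "{j. j < n \<and> j < k} = {..<k}" "{j. j < n \<and> k \<le> j} = {k..<n}" using assms(2) by auto
  then show "inv_num (Suc n) (cons_perm k \<sigma>) = k + inv_num n \<sigma>"
    and "cinv_num (Suc n) (cons_perm k \<sigma>) = n - k + cinv_num n \<sigma>"
    unfolding inv_num_def cinv_num_def card_first_coordinate_split cons_perm_simps skip_less
    by (simp_all add: card_permutes_Collect[OF assms(1), of "\<lambda>j. j < k"]
        card_permutes_Collect[OF assms(1), of "\<lambda>j. k \<le> j"])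
qed

lemma permute_list_cons_perm:
  assumes "\<sigma> permutes {..<n}" "k \<le> n" "length w = Suc n"
  shows "permute_list (cons_perm k \<sigma>) w = w ! k # permute_list \<sigma> (take k w @ drop (Suc k) w)"
proof (rule nth_equalityI)
  fix i assume "i < length (permute_list (cons_perm k \<sigma>) w)"
  then have i: "i < Suc n" using assms by simp
  show "permute_list (cons_perm k \<sigma>) w ! i = (w ! k # permute_list \<sigma> (take k w @ drop (Suc k) w)) ! i"
  proof (cases i)
    case (Suc j)
    then have "\<sigma> j < n" "j < n" using permutes_in_image[OF assms(1), of j] i by simp_all
    then show ?thesis using Suc i assms
      by (simp add: permute_list_def nth_append skip_def del: upt_Suc)
  qed (use assms in \<open>simp add: permute_list_def del: upt_Suc\<close>)
qed (use assms in simp)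

text \<open>A Laplace expansion with signs replaced by weights. The weights are exactly the
  coefficients in \<open>annihilation_word\<close>, so annihilation is the adjoint of
  creation.\<close>

lemma word_qt_Cons:
  "word_qt q t (x # v) w = (\<Sum>k<length w. of_real (q ^ k * t ^ (length w - 1 - k)) *
     cinner x (w ! k) * word_qt q t v (take k w @ drop (Suc k) w))"
proof (cases "length w")
  case 0
  then show ?thesis by (simp add: word_qt_length)
next
  case (Suc n)
  have "word_qt q t (x # v) w = (\<Sum>k<Suc n. \<Sum>\<sigma> | \<sigma> permutes {..<n}.
     of_real (q ^ inv_num (Suc n) (cons_perm k \<sigma>) * t ^ cinv_num (Suc n) (cons_perm k \<sigma>)) *
     word_inner (x # v) (permute_list (cons_perm k \<sigma>) w))"
    unfolding word_qt_def Suc sum.cartesian_product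
    by (subst sum.reindex_bij_betw[OF bij_betw_cons_perm, symmetric]) (simp add: case_prod_unfold)
  also have "\<dots> = (\<Sum>k<Suc n. \<Sum>\<sigma> | \<sigma> permutes {..<n}. of_real (q ^ k * t ^ (n - k)) * cinner x (w ! k) *
     (of_real (q ^ inv_num n \<sigma> * t ^ cinv_num n \<sigma>) *
       word_inner v (permute_list \<sigma> (take k w @ drop (Suc k) w))))"
  proof (intro sum.cong refl)
    fix k \<sigma> assume "k \<in> {..<Suc n}" "\<sigma> \<in> {\<sigma>. \<sigma> permutes {..<n}}"
    then have \<sigma>: "\<sigma> permutes {..<n}" and "k \<le> n" by simp_all
    note simps = inv_num_cons_perm[OF this] permute_list_cons_perm[OF this Suc] power_add
    show "of_real (q ^ inv_num (Suc n) (cons_perm k \<sigma>) * t ^ cinv_num (Suc n) (cons_perm k \<sigma>)) *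
        word_inner (x # v) (permute_list (cons_perm k \<sigma>) w) =
      of_real (q ^ k * t ^ (n - k)) * cinner x (w ! k) *
        (of_real (q ^ inv_num n \<sigma> * t ^ cinv_num n \<sigma>) *
         word_inner v (permute_list \<sigma> (take k w @ drop (Suc k) w)))"
      unfolding simps word_inner_Cons of_real_mult by (simp only: mult_ac)
  qed
  finally show ?thesis
    by (simp add: Suc word_qt_def sum_distrib_left)
qed

section \<open>Invariance of the deformed inner product under reversal of words\<close>

definition mirror :: "nat \<Rightarrow> nat \<Rightarrow> nat" where
  "mirror n i = (if i < n then n - Suc i else i)"

lemma mirror_mirror [simp]: "mirror n (mirror n i) = i"
  and mirror_less [simp]: "mirror n i < n \<longleftrightarrow> i < n"
  by (auto simp: mirror_def)

lemma mirror_less_mirror: "i < n \<Longrightarrow> j < n \<Longrightarrow> mirror n i < mirror n j \<longleftrightarrow> j < i"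
  by (auto simp: mirror_def)

lemma mirror_permutes: "mirror n permutes {..<n}"
  by (rule bij_imp_permutes, rule bij_betw_byWitness[where f' = "mirror n"])
    (auto simp: image_subset_iff, simp add: mirror_def)

lemma mirror_conjugate_permutes:
  assumes "\<pi> permutes {..<n}"
  shows "(mirror n \<circ> \<pi> \<circ> mirror n) permutes {..<n}"
  by (intro permutes_compose mirror_permutes assms)

text \<open>Positions and values are both reversed, so the order of values changes twice: the pair
  (i, j) corresponds to the pair of the mirror images of j and i, and is inverted exactly when that
  pair is.\<close>

lemma inv_num_mirror_conjugate:
  assumes "\<pi> permutes {..<n}"
  shows "inv_num n (mirror n \<circ> \<pi> \<circ> mirror n) = inv_num n \<pi>"
    and "cinv_num n (mirror n \<circ> \<pi> \<circ> mirror n) = cinv_num n \<pi>"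
proof -
  have [simp]: "\<pi> i < n \<longleftrightarrow> i < n" for i using permutes_in_image[OF assms, of i] by simp
  let ?m = "\<lambda>(i, j). (mirror n j, mirror n i)"
  show "inv_num n (mirror n \<circ> \<pi> \<circ> mirror n) = inv_num n \<pi>"
    unfolding inv_num_def
    by (rule bij_betw_same_card[of ?m], rule bij_betw_byWitness[where f' = ?m])
      (auto simp: mirror_less_mirror)
  show "cinv_num n (mirror n \<circ> \<pi> \<circ> mirror n) = cinv_num n \<pi>"
    unfolding cinv_num_def
    by (rule bij_betw_same_card[of ?m], rule bij_betw_byWitness[where f' = ?m])
      (auto simp: mirror_less_mirror)
qed

lemma permute_list_mirror_conjugate:
  assumes "\<pi> permutes {..<length w}"
  shows "permute_list (mirror (length w) \<circ> \<pi> \<circ> mirror (length w)) (rev w) = rev (permute_list \<pi> w)"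
proof (rule nth_equalityI)
  fix i assume "i < length (permute_list (mirror (length w) \<circ> \<pi> \<circ> mirror (length w)) (rev w))"
  then have i: "i < length w" by simp
  have "\<pi> (mirror (length w) i) < length w" "mirror (length w) i < length w"
    using permutes_in_image[OF assms, of "mirror (length w) i"] i by simp_all
  then show "permute_list (mirror (length w) \<circ> \<pi> \<circ> mirror (length w)) (rev w) ! i =
      rev (permute_list \<pi> w) ! i"
    using i by (simp add: permute_list_def rev_nth nth_append) (simp add: mirror_def)
qed simp

lemma word_inner_rev: "word_inner (rev v) (rev w) = word_inner v w"
proof (cases "length v = length w")
  case True
  have "(\<Prod>i<length w. cinner (rev v ! i) (rev w ! i)) = (\<Prod>i<length w. cinner (v ! i) (w ! i))"
    by (rule prod.reindex_bij_witness[of _ "mirror (length w)" "mirror (length w)"])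
      (auto simp: mirror_def rev_nth True)
  then show ?thesis by (simp add: word_inner_def True)
qed (simp add: word_inner_def)

lemma word_qt_rev: "word_qt q t (rev v) (rev w) = word_qt q t v w"
proof -
  let ?n = "length w"
  let ?c = "\<lambda>\<pi>. mirror ?n \<circ> \<pi> \<circ> mirror ?n"
  have inv: "?c (?c \<pi>) = \<pi>" for \<pi> by (simp add: fun_eq_iff)
  show ?thesis
    unfolding word_qt_def length_rev
  proof (rule sum.reindex_bij_witness[of _ ?c ?c])
    fix \<pi> assume "\<pi> \<in> {\<pi>. \<pi> permutes {..<?n}}"
    then have \<pi>: "\<pi> permutes {..<?n}" by simp
    show "?c (?c \<pi>) = \<pi>" "?c (?c \<pi>) = \<pi>" by (rule inv)+
    show "?c \<pi> \<in> {\<pi>. \<pi> permutes {..<?n}}" "?c \<pi> \<in> {\<pi>. \<pi> permutes {..<?n}}"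
      using mirror_conjugate_permutes[OF \<pi>] by simp_all
    have "word_inner (rev v) (permute_list \<pi> (rev w)) = word_inner v (permute_list (?c \<pi>) w)"
      using permute_list_mirror_conjugate[of "?c \<pi>" w] mirror_conjugate_permutes[OF \<pi>]
      by (simp only: inv word_inner_rev)
    then show "of_real (q ^ inv_num ?n (?c \<pi>) * t ^ cinv_num ?n (?c \<pi>)) *
        word_inner v (permute_list (?c \<pi>) w) =
      of_real (q ^ inv_num ?n \<pi> * t ^ cinv_num ?n \<pi>) * word_inner (rev v) (permute_list \<pi> (rev w))"
      by (simp only: inv_num_mirror_conjugate[OF \<pi>])
  qed
qed

section \<open>Creation and annihilation operators on the completion\<close>

text \<open>Transfers a norm bound to the adjoint: a is the norm of the annihilated vector, c the
  norm after creating again, b the norm of the original vector. The first hypothesis is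
  Cauchy-Schwarz, and a^2 is cancelled at the end.\<close>

lemma square_le_of_duality:
  fixes a b c B :: real
  assumes "a\<^sup>2 \<le> c * b" "c\<^sup>2 \<le> B * a\<^sup>2" "0 \<le> B"
  shows "a\<^sup>2 \<le> B * b\<^sup>2"
proof (cases "a = 0")
  case False
  have "(a\<^sup>2)\<^sup>2 \<le> (c * b)\<^sup>2" using assms(1) by (intro power_mono) auto
  also have "\<dots> = c\<^sup>2 * b\<^sup>2" by (rule power_mult_distrib)
  also have "\<dots> \<le> (B * a\<^sup>2) * b\<^sup>2" using assms(2) by (intro mult_right_mono) auto
  finally have "a\<^sup>2 * a\<^sup>2 \<le> a\<^sup>2 * (B * b\<^sup>2)" by (simp add: power2_eq_square mult_ac)
  moreover have "0 < a\<^sup>2" using False by simp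
  ultimately show ?thesis by (rule mult_left_le_imp_le)
qed (use assms(3) in simp)

lemma norm_sum_orthogonal_sq:
  fixes g :: "nat \<Rightarrow> 'k::complex_hilbert"
  assumes "\<And>i j. i \<noteq> j \<Longrightarrow> cinner (g i) (g j) = 0"
  shows "(norm (\<Sum>n<N. g n))\<^sup>2 = (\<Sum>n<N. (norm (g n))\<^sup>2)"
proof (induction N)
  case (Suc N)
  have "cinner (\<Sum>n<N. g n) (g N) = 0" by (simp add: cinner_sum_left assms)
  with Suc show ?case by (simp add: norm_add_sq)
qed simp

lemma dense_range_eqI:
  fixes f g :: "'k::complex_hilbert \<Rightarrow> 'b::real_normed_vector"
  assumes "closure (range \<iota>) = UNIV" "bounded_linear f" "bounded_linear g" "\<And>\<xi>. f (\<iota> \<xi>) = g (\<iota> \<xi>)"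
  shows "f x = g x"
proof -
  have "closed {x. f x = g x}"
    by (intro closed_Collect_eq linear_continuous_on assms)
  then have "closure (range \<iota>) \<subseteq> {x. f x = g x}"
    by (intro closure_minimal) (use assms(4) in auto)
  then show ?thesis using assms(1) by auto
qed

lemma clinear_zero: "clinear (\<lambda>_. 0)"
  and clinear_ident: "clinear (\<lambda>x. x)"
  by (simp_all add: clinear_def)

locale fock_space =
  fixes q t :: real and \<iota> :: "'a::real_inner fock \<Rightarrow> 'k::complex_hilbert"
  assumes q_less: "\<bar>q\<bar> < t" and t_le: "t \<le> 1" and completion: "fock_completion q t \<iota>"
begin

abbreviation bra :: "'a fock \<Rightarrow> 'a fock \<Rightarrow> complex" where
  "bra \<eta> \<xi> \<equiv> cinner (\<iota> \<eta>) (\<iota> \<xi>)"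

lemma iota: "clinear \<iota>" and dense: "closure (range \<iota>) = UNIV"
  and inner_tensor: "bra (tensor v) (tensor w) = word_qt q t v w"
  using completion by (simp_all add: fock_completion_def inner_qt_tensor)

lemmas iota_simps = clinear_0[OF iota] clinear_add[OF iota] clinear_diff[OF iota]
  clinear_scaleC[OF iota] clinear_sum[OF iota]

lemma sesquilinear_eqI:
  assumes lin: "clinear A" "clinear B" "clinear C" "clinear D"
    and eq: "\<And>v w. bra (A (tensor v)) (B (tensor w)) = bra (C (tensor v)) (D (tensor w))"
  shows "bra (A \<eta>) (B \<xi>) = bra (C \<eta>) (D \<xi>)"
proof (induction \<eta> rule: tensor_algebra_induct)
  case zero
  show ?case by (simp add: clinear_0[OF lin(1)] clinear_0[OF lin(3)] iota_simps)
next
  case (add \<eta> c v)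
  have "bra (A (tensor v)) (B \<xi>) = bra (C (tensor v)) (D \<xi>)"
    by (rule clinear_tensor_eqI[OF clinear_compose[OF clinear_cinner clinear_compose[OF iota lin(2)]]
          clinear_compose[OF clinear_cinner clinear_compose[OF iota lin(4)]] eq])
  with add show ?case
    by (simp add: clinear_add[OF lin(1)] clinear_add[OF lin(3)] clinear_scaleC[OF lin(1)]
        clinear_scaleC[OF lin(3)] iota_simps cinner_add_left cinner_scaleC_left)
qed

lemma bra_commute: "bra \<eta> \<xi> = cnj (bra \<xi> \<eta>)"
  by (rule cinner_commute)

lemma creation_annihilation: "bra (creation f \<eta>) \<xi> = bra \<eta> (annihilation q t f \<xi>)"
proof (rule sesquilinear_eqI[where A = "creation f" and B = "\<lambda>\<xi>. \<xi>" and C = "\<lambda>\<eta>. \<eta>"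
      and D = "annihilation q t f"])
  show "bra (creation f (tensor v)) (tensor w) = bra (tensor v) (annihilation q t f (tensor w))" for v w
    by (simp add: creation_tensor annihilation_tensor_sum iota_simps cinner_sum_right
        cinner_scaleC_right inner_tensor word_qt_Cons)
qed (rule clinear_creation clinear_annihilation clinear_ident)+

lemma annihilation_creation: "bra (annihilation q t f \<eta>) \<xi> = bra \<eta> (creation f \<xi>)"
  by (metis bra_commute creation_annihilation)

lemma bra_reversal: "bra (reversal \<eta>) (reversal \<xi>) = bra \<eta> \<xi>"
  by (rule sesquilinear_eqI[where A = reversal and B = reversal and C = "\<lambda>\<eta>. \<eta>" and D = "\<lambda>\<xi>. \<xi>"])
    (simp_all add: clinear_reversal clinear_ident inner_tensor word_qt_rev)

lemma bra_particle_part: "i \<noteq> j \<Longrightarrow> bra (particle_part i \<eta>) (particle_part j \<xi>) = 0"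
proof -
  assume ij: "i \<noteq> j"
  have "bra (particle_part i \<eta>) (particle_part j \<xi>) = bra 0 0"
  proof (rule sesquilinear_eqI[where A = "particle_part i" and B = "particle_part j" and C = "\<lambda>_. 0" and D = "\<lambda>_. 0"])
    show "bra (particle_part i (tensor v)) (particle_part j (tensor w)) = bra 0 0" for v w
      using ij by (simp add: particle_part_tensor iota_simps inner_tensor word_qt_length)
  qed (rule clinear_particle_part clinear_zero)+
  then show ?thesis by (simp add: iota_simps)
qed

text \<open>For \<open>q > 0\<close> the relation \<open>a a\<^sup>* = q a\<^sup>* a + \<parallel>f\<parallel>\<^sup>2 t\<^sup>n\<close> reproduces a bound \<open>B\<close> for \<open>\<parallel>a\<^sup>*\<parallel>\<^sup>2\<close> from one
  particle number to the next as soon as \<open>q B + \<parallel>f\<parallel>\<^sup>2 \<le> B\<close>.\<close>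

definition bound :: "'a \<Rightarrow> real" where
  "bound f = (norm f)\<^sup>2 / (1 - max q 0)"

lemma bound_nonneg: "0 \<le> bound f"
  and bound_eq: "max q 0 * bound f + (norm f)\<^sup>2 = bound f"
proof -
  have "1 - max q 0 > 0" using q_less t_le by auto
  then show "0 \<le> bound f" "max q 0 * bound f + (norm f)\<^sup>2 = bound f"
    by (simp_all add: bound_def field_simps)
qed

text \<open>The bound on creation is assumed at the annihilated vector only. That vector has one
  particle less, so an induction on the particle number can supply it.\<close>

lemma annihilation_bound_aux:
  assumes "(norm (\<iota> (creation f (annihilation q t f \<xi>))))\<^sup>2 \<le> bound f * (norm (\<iota> (annihilation q t f \<xi>)))\<^sup>2"
  shows "(norm (\<iota> (annihilation q t f \<xi>)))\<^sup>2 \<le> bound f * (norm (\<iota> \<xi>))\<^sup>2"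
proof (rule square_le_of_duality[OF _ assms bound_nonneg])
  have "(norm (\<iota> (annihilation q t f \<xi>)))\<^sup>2 = Re (bra (creation f (annihilation q t f \<xi>)) \<xi>)"
    by (simp add: norm_sq_cinner creation_annihilation)
  then show "(norm (\<iota> (annihilation q t f \<xi>)))\<^sup>2 \<le>
      norm (\<iota> (creation f (annihilation q t f \<xi>))) * norm (\<iota> \<xi>)"
    by (simp add: Re_cinner_le)
qed

text \<open>Two bounds alternate: creation on n particles bounds annihilation on n + 1 by duality,
  and the commutation relation turns this into a bound for creation on n + 1. The start is that
  annihilation kills the vacuum.\<close>

lemma creation_bound_particle_part:
  "(norm (\<iota> (creation f (particle_part n \<xi>))))\<^sup>2 \<le> bound f * (norm (\<iota> (particle_part n \<xi>)))\<^sup>2"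
proof (induction n arbitrary: \<xi>)
  let ?a = "annihilation q t f"
  have step: "(norm (\<iota> (creation f (particle_part n \<xi>))))\<^sup>2 \<le> bound f * (norm (\<iota> (particle_part n \<xi>)))\<^sup>2"
    if "(norm (\<iota> (?a (particle_part n \<xi>))))\<^sup>2 \<le> bound f * (norm (\<iota> (particle_part n \<xi>)))\<^sup>2" for n \<xi>
  proof -
    let ?z = "particle_part n \<xi>"
    have "(norm (\<iota> (creation f ?z)))\<^sup>2 = Re (bra ?z (?a (creation f ?z)))"
      by (simp add: norm_sq_cinner creation_annihilation)
    also have "\<dots> = q * (norm (\<iota> (?a ?z)))\<^sup>2 + t ^ n * (norm f)\<^sup>2 * (norm (\<iota> ?z))\<^sup>2"
      unfolding annihilation_creation_particle_part
      by (simp add: iota_simps cinner_add_right cinner_scaleC_right annihilation_creation[symmetric]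
          norm_sq_cinner power2_norm_eq_inner del: of_real_mult of_real_power)
    \<comment> \<open>For q < 0 the first term is at most 0 and is dropped, which explains the
      maximum; in the second term t^n is at most 1.\<close>
    also have "\<dots> \<le> max q 0 * (bound f * (norm (\<iota> ?z))\<^sup>2) + 1 * (norm f)\<^sup>2 * (norm (\<iota> ?z))\<^sup>2"
      using q_less t_le that
      by (intro add_mono mult_right_mono order_trans[OF mult_right_mono[of q "max q 0"] mult_left_mono])
        (auto intro!: power_le_one)
    also have "\<dots> = (max q 0 * bound f + (norm f)\<^sup>2) * (norm (\<iota> ?z))\<^sup>2"
      by (simp add: algebra_simps)
    finally show ?thesis by (simp only: bound_eq)
  qed
  case 0
  show ?case
    by (rule step) (simp add: annihilation_particle_part_0 iota_simps bound_nonneg)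
  case (Suc n)
  show ?case
    by (rule step, rule annihilation_bound_aux) (simp only: annihilation_particle_part_Suc Suc.IH)
qed

text \<open>Creation keeps different particle numbers orthogonal, so the bounds on the single levels
  add up with the same constant.\<close>

lemma creation_bound: "(norm (\<iota> (creation f \<xi>)))\<^sup>2 \<le> bound f * (norm (\<iota> \<xi>))\<^sup>2"
proof -
  obtain N where N: "(\<Sum>n<N. particle_part n \<xi>) = \<xi>" using sum_particle_part by blast
  have "\<iota> (creation f \<xi>) = (\<Sum>n<N. \<iota> (creation f (particle_part n \<xi>)))"
    using N by (metis clinear_sum[OF clinear_creation] iota_simps(5))
  moreover have "(norm (\<Sum>n<N. \<iota> (creation f (particle_part n \<xi>))))\<^sup>2 =
      (\<Sum>n<N. (norm (\<iota> (creation f (particle_part n \<xi>))))\<^sup>2)"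
    by (simp add: norm_sum_orthogonal_sq creation_particle_part bra_particle_part)
  ultimately have "(norm (\<iota> (creation f \<xi>)))\<^sup>2 = (\<Sum>n<N. (norm (\<iota> (creation f (particle_part n \<xi>))))\<^sup>2)"
    by simp
  also have "\<dots> \<le> (\<Sum>n<N. bound f * (norm (\<iota> (particle_part n \<xi>)))\<^sup>2)"
    by (intro sum_mono creation_bound_particle_part)
  also have "\<dots> = bound f * (norm (\<Sum>n<N. \<iota> (particle_part n \<xi>)))\<^sup>2"
    by (simp add: norm_sum_orthogonal_sq bra_particle_part sum_distrib_left)
  also have "(\<Sum>n<N. \<iota> (particle_part n \<xi>)) = \<iota> \<xi>"
    using N by (simp add: iota_simps(5)[symmetric])
  finally show ?thesis .
qed

lemma annihilation_bound: "(norm (\<iota> (annihilation q t f \<xi>)))\<^sup>2 \<le> bound f * (norm (\<iota> \<xi>))\<^sup>2"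
  by (intro annihilation_bound_aux creation_bound)

text \<open>Gives the definite description in \<open>bounded_extension\<close> its meaning: a
  Lipschitz map on the dense range extends to the closure, and two bounded extensions agree by
  density.\<close>

lemma bounded_extension:
  assumes T: "clinear T" and bounded: "\<And>\<xi>. norm (\<iota> (T \<xi>)) \<le> K * norm (\<iota> \<xi>)" and "0 \<le> K"
  shows "bounded_clinear (bounded_extension \<iota> T)"
    and "bounded_extension \<iota> T (\<iota> \<xi>) = \<iota> (T \<xi>)"
proof -
  define f where "f v = \<iota> (T (SOME \<xi>. \<iota> \<xi> = v))" for v
  \<comment> \<open>The chosen preimage does not matter: by the bound, T maps the kernel of \<iota>
    into itself.\<close>
  have f: "f (\<iota> \<xi>) = \<iota> (T \<xi>)" for \<xi>
  proof -
    define \<eta> where "\<eta> = (SOME \<eta>. \<iota> \<eta> = \<iota> \<xi>)"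
    have "\<iota> \<eta> = \<iota> \<xi>" unfolding \<eta>_def by (rule someI) simp
    then have "norm (\<iota> (T (\<eta> - \<xi>))) \<le> 0" using bounded[of "\<eta> - \<xi>"] by (simp add: iota_simps)
    then show ?thesis by (simp add: f_def \<eta>_def[symmetric] clinear_diff[OF T] iota_simps)
  qed
  have "K-lipschitz_on (range \<iota>) f"
  proof (rule lipschitz_onI)
    fix x y assume "x \<in> range \<iota>" "y \<in> range \<iota>"
    then obtain \<xi> \<eta> where "x = \<iota> \<xi>" "y = \<iota> \<eta>" by blast
    then show "dist (f x) (f y) \<le> K * dist x y"
      using bounded[of "\<xi> - \<eta>"] by (simp add: f dist_norm iota_simps clinear_diff[OF T])
  qed fact
  then have "uniformly_continuous_on (range \<iota>) f"
    by (rule lipschitz_on_uniformly_continuous)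
  then obtain g where "uniformly_continuous_on (closure (range \<iota>)) g"
    and fg: "\<And>x. x \<in> range \<iota> \<Longrightarrow> f x = g x"
    by (rule uniformly_continuous_on_extension_on_closure) blast
  then have cont: "continuous_on UNIV g"
    using uniformly_continuous_imp_continuous by (simp add: dense)
  have g: "g (\<iota> \<xi>) = \<iota> (T \<xi>)" for \<xi> using fg[of "\<iota> \<xi>"] f by simp
  have g_lim: "(\<lambda>n. g (X n)) \<longlonglongrightarrow> g x" if "X \<longlonglongrightarrow> x" for X x
    using continuous_on_tendsto_compose[OF cont that] by simp
  have approx: "\<exists>X. (\<lambda>n. \<iota> (X n)) \<longlonglongrightarrow> x" for x
  proof -
    have "x \<in> closure (range \<iota>)" by (simp add: dense)
    then obtain Y where Y: "\<forall>n. Y n \<in> range \<iota>" "Y \<longlonglongrightarrow> x" unfolding closure_sequential by auto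
    have "\<iota> (inv \<iota> (Y n)) = Y n" for n using Y(1) by (simp add: f_inv_into_f)
    with Y(2) have "(\<lambda>n. \<iota> (inv \<iota> (Y n))) \<longlonglongrightarrow> x" by simp
    then show ?thesis by (rule exI[of _ "\<lambda>n. inv \<iota> (Y n)"])
  qed
  have "bounded_clinear g"
    unfolding bounded_clinear_def clinear_def
  proof (intro conjI allI exI)
    fix x y c
    obtain X where X: "(\<lambda>n. \<iota> (X n)) \<longlonglongrightarrow> x" using approx[of x] by (rule exE)
    obtain Y where Y: "(\<lambda>n. \<iota> (Y n)) \<longlonglongrightarrow> y" using approx[of y] by (rule exE)
    have "(\<lambda>n. g (\<iota> (X n + Y n))) \<longlonglongrightarrow> g (x + y)"
      by (rule g_lim) (use tendsto_add[OF X Y] in \<open>simp add: iota_simps\<close>)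
    moreover have "(\<lambda>n. g (\<iota> (X n + Y n))) \<longlonglongrightarrow> g x + g y"
      using tendsto_add[OF g_lim[OF X] g_lim[OF Y]] unfolding g unfolding clinear_add[OF T] iota_simps .
    ultimately show "g (x + y) = g x + g y" by (rule LIMSEQ_unique)
    have "(\<lambda>n. g (\<iota> (c *\<^sub>C X n))) \<longlonglongrightarrow> g (c *\<^sub>C x)"
      by (rule g_lim) (use bounded_linear.tendsto[OF bounded_linear_scaleC X] in \<open>simp add: iota_simps\<close>)
    moreover have "(\<lambda>n. g (\<iota> (c *\<^sub>C X n))) \<longlonglongrightarrow> c *\<^sub>C g x"
      using bounded_linear.tendsto[OF bounded_linear_scaleC g_lim[OF X]]
      unfolding g unfolding clinear_scaleC[OF T] iota_simps .
    ultimately show "g (c *\<^sub>C x) = c *\<^sub>C g x" by (rule LIMSEQ_unique)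
    show "norm (g x) \<le> K * norm x"
      by (rule LIMSEQ_le[OF tendsto_norm[OF g_lim[OF X]] tendsto_mult_left[OF tendsto_norm[OF X]]])
        (simp add: g bounded)
  qed
  moreover have "S = g" if "bounded_clinear S" "\<forall>\<xi>. S (\<iota> \<xi>) = \<iota> (T \<xi>)" for S
    using dense_range_eqI[OF dense that(1)[THEN bounded_clinear_bounded_linear]
        \<open>bounded_clinear g\<close>[THEN bounded_clinear_bounded_linear]] that(2) g
    by (simp add: fun_eq_iff)
  ultimately have "\<exists>!S. bounded_clinear S \<and> (\<forall>\<xi>. S (\<iota> \<xi>) = \<iota> (T \<xi>))"
    using g by blast
  from theI'[OF this] show "bounded_clinear (bounded_extension \<iota> T)" "bounded_extension \<iota> T (\<iota> \<xi>) = \<iota> (T \<xi>)"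
    by (simp_all add: bounded_extension_def)
qed

section \<open>Self-adjointness of the field operators\<close>

lemma is_adjointI:
  assumes "bounded_clinear S" "bounded_clinear T" "\<And>\<eta> \<xi>. cinner (S (\<iota> \<eta>)) (\<iota> \<xi>) = cinner (\<iota> \<eta>) (T (\<iota> \<xi>))"
  shows "is_adjoint S T"
proof -
  note bl = assms(1,2)[THEN bounded_clinear_bounded_linear]
  have left: "cinner (S (\<iota> \<eta>)) y = cinner (\<iota> \<eta>) (T y)" for \<eta> y
    by (rule dense_range_eqI[OF dense bounded_linear_cinner bounded_linear_compose[OF bounded_linear_cinner bl(2)]])
      (rule assms(3))
  have "cinner y (S x) = cinner (T y) x" for x y
  proof (rule dense_range_eqI[OF dense bounded_linear_compose[OF bounded_linear_cinner bl(1)] bounded_linear_cinner])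
    show "cinner y (S (\<iota> \<xi>)) = cinner (T y) (\<iota> \<xi>)" for \<xi>
      using left[of \<xi> y] by (metis cinner_commute)
  qed
  then show ?thesis
    unfolding is_adjoint_def by (metis cinner_commute)
qed

definition field_op :: "'a \<Rightarrow> 'a fock \<Rightarrow> 'a fock" where
  "field_op h \<xi> = annihilation q t h \<xi> + creation h \<xi>"

lemma clinear_field_op: "clinear (field_op h)"
  unfolding field_op_def by (rule clinear_plus[OF clinear_annihilation clinear_creation])

lemma bra_field: "bra (field_op h \<eta>) \<xi> = bra \<eta> (field_op h \<xi>)"
  by (simp add: field_op_def iota_simps cinner_add_left cinner_add_right creation_annihilation
      annihilation_creation)

lemma s_qt_iota: "s_qt q t \<iota> h (\<iota> \<xi>) = \<iota> (field_op h \<xi>)"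
  and bounded_clinear_s_qt: "bounded_clinear (s_qt q t \<iota> h)"
proof -
  have root: "norm (\<iota> (T \<xi>)) \<le> sqrt (bound h) * norm (\<iota> \<xi>)"
    if "\<And>\<xi>. (norm (\<iota> (T \<xi>)))\<^sup>2 \<le> bound h * (norm (\<iota> \<xi>))\<^sup>2" for T \<xi>
    using real_sqrt_le_mono[OF that[of \<xi>]] by (simp add: real_sqrt_mult)
  note a = bounded_extension[OF clinear_annihilation[of q t h] root[OF annihilation_bound]
      real_sqrt_ge_zero[OF bound_nonneg]]
  note c = bounded_extension[OF clinear_creation[of h] root[OF creation_bound]
      real_sqrt_ge_zero[OF bound_nonneg]]
  show "s_qt q t \<iota> h (\<iota> \<xi>) = \<iota> (field_op h \<xi>)" "bounded_clinear (s_qt q t \<iota> h)"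
    unfolding s_qt_def by (simp_all add: a c field_op_def iota_simps bounded_clinear_add)
qed

lemma is_adjoint_s_qt: "is_adjoint (s_qt q t \<iota> h) (s_qt q t \<iota> h)"
  by (intro is_adjointI bounded_clinear_s_qt) (simp add: s_qt_iota bra_field)

section \<open>The trace property for t = 1\<close>

definition right_creation :: "'a \<Rightarrow> 'a fock \<Rightarrow> 'a fock" where
  "right_creation h \<xi> = reversal (creation h (reversal \<xi>))"

definition right_annihilation :: "'a \<Rightarrow> 'a fock \<Rightarrow> 'a fock" where
  "right_annihilation h \<xi> = reversal (annihilation q t h (reversal \<xi>))"

definition right_field :: "'a \<Rightarrow> 'a fock \<Rightarrow> 'a fock" where
  "right_field h \<xi> = reversal (field_op h (reversal \<xi>))"

lemma right_field_eq: "right_field h \<xi> = right_annihilation h \<xi> + right_creation h \<xi>"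
  by (simp add: right_field_def right_annihilation_def right_creation_def field_op_def
      clinear_add[OF clinear_reversal])

lemma clinear_right_creation: "clinear (right_creation h)"
  unfolding right_creation_def
  by (rule clinear_compose[OF clinear_reversal clinear_compose[OF clinear_creation clinear_reversal]])

lemma clinear_right_field: "clinear (right_field h)"
  unfolding right_field_def
  by (rule clinear_compose[OF clinear_reversal clinear_compose[OF clinear_field_op clinear_reversal]])

lemma bra_reversal_left: "bra (reversal \<eta>) \<xi> = bra \<eta> (reversal \<xi>)"
  by (metis bra_reversal reversal_reversal)

lemma right_creation_annihilation: "bra (right_creation h \<eta>) \<xi> = bra \<eta> (right_annihilation h \<xi>)"
  by (simp add: right_creation_def right_annihilation_def bra_reversal_left creation_annihilation)

lemma bra_right_field: "bra (right_field h \<eta>) \<xi> = bra \<eta> (right_field h \<xi>)"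
  by (simp add: right_field_def bra_reversal_left bra_field)

lemma right_creation_tensor: "right_creation h (tensor w) = tensor (w @ [to_cplx h])"
  by (simp add: right_creation_def creation_tensor)

lemma creation_right_creation: "creation f (right_creation h \<xi>) = right_creation h (creation f \<xi>)"
  by (rule clinear_tensor_eqI[OF clinear_compose[OF clinear_creation clinear_right_creation]
        clinear_compose[OF clinear_right_creation clinear_creation]])
    (simp add: right_creation_tensor creation_tensor)

text \<open>The appended letter stands behind all others, so their coefficients change only by a
  factor t, here 1. The letter itself has the n letters of w before it and contributes q^n
  <f,h>.\<close>

lemma annihilation_right_creation_tensor:
  assumes "t = 1"
  shows "annihilation q t f (right_creation h (tensor w)) =
    right_creation h (annihilation q t f (tensor w)) + of_real (q ^ length w * (f \<bullet> h)) *\<^sub>C tensor w"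
proof -
  have "right_creation h (annihilation q t f (tensor w)) =
    (\<Sum>k<length w. (of_real (q ^ k) * cinner (to_cplx f) (w ! k)) *\<^sub>C
       tensor (take k w @ drop (Suc k) w @ [to_cplx h]))"
    by (simp add: annihilation_tensor_sum clinear_sum[OF clinear_right_creation] assms
        clinear_scaleC[OF clinear_right_creation] right_creation_tensor)
  moreover have "annihilation q t f (tensor (w @ [to_cplx h])) =
    (\<Sum>k<length w. (of_real (q ^ k) * cinner (to_cplx f) (w ! k)) *\<^sub>C
       tensor (take k w @ drop (Suc k) w @ [to_cplx h])) +
    of_real (q ^ length w * (f \<bullet> h)) *\<^sub>C tensor w"
    by (simp add: annihilation_tensor_sum assms cinner_to_cplx nth_append)
  ultimately show ?thesis by (simp add: right_creation_tensor)
qed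

text \<open>Operations at the two ends commute when both create or, by taking adjoints, both
  annihilate. What remains are the two mixed commutators, which cancel.\<close>

lemma field_right_field:
  assumes "t = 1"
  shows "\<iota> (field_op f (right_field h \<xi>)) = \<iota> (right_field h (field_op f \<xi>))"
proof -
  have "bra (tensor v) (field_op f (right_field h (tensor w))) =
      bra (tensor v) (right_field h (field_op f (tensor w)))" for v w
  proof -
    let ?v = "tensor v" and ?w = "tensor w"
    let ?a = "annihilation q t f" and ?c = "creation f"
    let ?ra = "right_annihilation h" and ?rc = "right_creation h"
    have ra_lin: "?ra (x + y) = ?ra x + ?ra y" for x y
      by (simp add: right_annihilation_def clinear_add[OF clinear_reversal] clinear_add[OF clinear_annihilation])
    have aa: "bra ?v (?a (?ra ?w)) = bra ?v (?ra (?a ?w))"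
      by (simp add: creation_annihilation[symmetric] right_creation_annihilation[symmetric]
          creation_right_creation)
    have ca: "bra ?v (?ra (?c ?w)) = bra ?v (?c (?ra ?w)) + of_real (q ^ length v * (f \<bullet> h)) * bra ?v ?w"
    proof -
      have "bra ?v (?ra (?c ?w)) = bra (?a (?rc ?v)) ?w"
        by (simp only: right_creation_annihilation[symmetric] annihilation_creation)
      also have "\<dots> = bra (?rc (?a ?v)) ?w + of_real (q ^ length v * (f \<bullet> h)) * bra ?v ?w"
        unfolding annihilation_right_creation_tensor[OF assms]
        by (simp add: iota_simps cinner_add_left cinner_scaleC_left)
      also have "bra (?rc (?a ?v)) ?w = bra ?v (?c (?ra ?w))"
        by (simp only: right_creation_annihilation annihilation_creation)
      finally show ?thesis .
    qed
    have ac: "bra ?v (?a (?rc ?w)) = bra ?v (?rc (?a ?w)) + of_real (q ^ length w * (f \<bullet> h)) * bra ?v ?w"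
      unfolding annihilation_right_creation_tensor[OF assms]
      by (simp add: iota_simps cinner_add_right cinner_scaleC_right)
    \<comment> \<open>One commutator was computed on w, the other by duality on v. The exponents
      agree unless the lengths differ, and then the words are orthogonal.\<close>
    have "of_real (q ^ length w * (f \<bullet> h)) * bra ?v ?w = of_real (q ^ length v * (f \<bullet> h)) * bra ?v ?w"
      by (cases "length v = length w") (simp_all add: inner_tensor word_qt_length)
    then show ?thesis
      using aa ca ac
      by (simp add: field_op_def right_field_eq iota_simps cinner_add_right clinear_add[OF clinear_annihilation]
          clinear_add[OF clinear_creation] clinear_add[OF clinear_right_creation] ra_lin
          creation_right_creation)
  qed
  then have eq: "bra \<eta> (field_op f (right_field h \<xi>)) = bra \<eta> (right_field h (field_op f \<xi>))" for \<eta>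
    by (rule sesquilinear_eqI[OF clinear_ident clinear_compose[OF clinear_field_op clinear_right_field]
          clinear_ident clinear_compose[OF clinear_right_field clinear_field_op]])
  define \<delta> where "\<delta> = field_op f (right_field h \<xi>) - right_field h (field_op f \<xi>)"
  have "bra \<delta> \<delta> = 0"
    using eq[of \<delta>] by (simp add: \<delta>_def iota_simps cinner_diff_right)
  then show ?thesis by (simp add: cinner_eq_zero_iff \<delta>_def iota_simps)
qed

lemma tracial_if_t_eq_1:
  assumes t: "t = 1" and x: "x \<in> Gamma_qt q t \<iota>" and y: "y \<in> Gamma_qt q t \<iota>"
  shows "vacuum_state \<iota> (x \<circ> y) = vacuum_state \<iota> (y \<circ> x)"
proof -
  let ?G = "range (s_qt q t \<iota>)" and ?\<Omega> = "\<iota> vacuum"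
  have G: "bounded_clinear T \<and> is_adjoint T T" if "T \<in> ?G" for T
    using that bounded_clinear_s_qt is_adjoint_s_qt by blast
  have trace: "cinner ?\<Omega> (g (y ?\<Omega>)) = cinner ?\<Omega> (y (g ?\<Omega>))"
    if g_in: "g \<in> ?G" and y: "y \<in> star_algebra ?G" for g y
  proof -
    obtain h where g: "g = s_qt q t \<iota> h" using g_in by blast
    define R where "R = bounded_extension \<iota> (right_field h)"
    obtain K where K: "0 \<le> K" "\<And>x. norm (s_qt q t \<iota> h x) \<le> norm x * K"
      using bounded_linear.nonneg_bounded[OF bounded_clinear_bounded_linear[OF bounded_clinear_s_qt[of h]]]
      by blast
    \<comment> \<open>As reversal preserves norms, the right field operator inherits the bound K of
      the left one and extends to the completion.\<close>
    have "norm (\<iota> (reversal \<xi>)) = norm (\<iota> \<xi>)" for \<xi>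
      by (simp add: norm_eq_sqrt_cinner bra_reversal)
    then have "norm (\<iota> (right_field h \<xi>)) \<le> K * norm (\<iota> \<xi>)" for \<xi>
      using K(2)[of "\<iota> (reversal \<xi>)"] by (simp add: right_field_def s_qt_iota mult.commute)
    note R = bounded_extension[OF clinear_right_field this K(1), folded R_def]
    have adj: "is_adjoint R R"
      by (intro is_adjointI R) (simp add: R bra_right_field)
    have "T (R x) = R (T x)" if T: "T \<in> ?G" for T x
    proof -
      obtain f where T: "T = s_qt q t \<iota> f" using T by blast
      note bl = bounded_clinear_bounded_linear[OF R(1)] bounded_clinear_bounded_linear[OF bounded_clinear_s_qt]
      show ?thesis unfolding T
        by (rule dense_range_eqI[OF dense bounded_linear_compose[OF bl(2,1)] bounded_linear_compose[OF bl]])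
          (simp add: R s_qt_iota field_right_field[OF t])
    qed
    from star_algebra_commute[OF this R(1) adj y] have comm: "y (R ?\<Omega>) = R (y ?\<Omega>)" .
    have vac: "R ?\<Omega> = g ?\<Omega>"
      by (simp add: R g s_qt_iota right_field_def field_op_def vacuum_def annihilation_tensor_sum
          creation_tensor)
    have "cinner ?\<Omega> (g (y ?\<Omega>)) = cinner (g ?\<Omega>) (y ?\<Omega>)"
      using is_adjoint_s_qt[of h] by (simp add: is_adjoint_def g)
    also have "\<dots> = cinner ?\<Omega> (R (y ?\<Omega>))"
      using adj by (simp add: is_adjoint_def vac[symmetric])
    finally show ?thesis by (simp only: comm[symmetric] vac)
  qed
  have "cinner ?\<Omega> (x (y ?\<Omega>)) = cinner ?\<Omega> (y (x ?\<Omega>))"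
  proof (rule vector_state_tracial[where G = ?G and x = x and y = y])
    show "cinner ?\<Omega> (g (z ?\<Omega>)) = cinner ?\<Omega> (z (g ?\<Omega>))" if "g \<in> ?G" "z \<in> star_algebra ?G" for g z
      using that by (rule trace)
  qed (use G x y in \<open>simp_all only: Gamma_qt_def\<close>)
  then show ?thesis by (simp add: vacuum_state_def)
qed

section \<open>Failure of the trace property for t < 1\<close>

text \<open>By orthogonality only pairings of equal letters contribute. In x x y y each letter is
  removed from a word of length one, at no cost. In x y y x the letter y is removed while x stands
  behind it, which costs the factor t.\<close>

lemma vacuum_state_s_qt_words:
  assumes "x \<bullet> y = 0"
  defines "X \<equiv> s_qt q t \<iota> x" and "Y \<equiv> s_qt q t \<iota> y"
  shows "vacuum_state \<iota> (X \<circ> (X \<circ> (Y \<circ> Y))) = of_real ((x \<bullet> x) * (y \<bullet> y))"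
    and "vacuum_state \<iota> ((X \<circ> (Y \<circ> Y)) \<circ> X) = of_real (t * ((x \<bullet> x) * (y \<bullet> y)))"
proof -
  have yx: "y \<bullet> x = 0" using assms(1) by (simp add: inner_commute)
  have nil: "word_qt q t [] [] = 1"
    by (simp add: word_qt_def inv_num_def cinv_num_def word_inner_def)
  note simps = vacuum_def field_op_def creation_tensor annihilation_tensor_sum
    clinear_add[OF clinear_annihilation] clinear_add[OF clinear_creation]
    clinear_scaleC[OF clinear_annihilation] clinear_scaleC[OF clinear_creation]
    cinner_to_cplx assms(1) yx iota_simps cinner_add_right cinner_scaleC_right inner_tensor
    word_qt_length nil eval_nat_numeral
  show "vacuum_state \<iota> (X \<circ> (X \<circ> (Y \<circ> Y))) = of_real ((x \<bullet> x) * (y \<bullet> y))"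
    unfolding vacuum_state_def X_def Y_def o_apply s_qt_iota by (simp add: simps)
  show "vacuum_state \<iota> ((X \<circ> (Y \<circ> Y)) \<circ> X) = of_real (t * ((x \<bullet> x) * (y \<bullet> y)))"
    unfolding vacuum_state_def X_def Y_def o_apply s_qt_iota by (simp add: simps)
qed

lemma star_algebra_in_Gamma: "T \<in> star_algebra (range (s_qt q t \<iota>)) \<Longrightarrow> T \<in> Gamma_qt q t \<iota>"
proof -
  assume T: "T \<in> star_algebra (range (s_qt q t \<iota>))"
  have "star_algebra (range (s_qt q t \<iota>)) \<subseteq> topspace weak_operator_topology"
    using star_algebra_bounded_clinear[of "range (s_qt q t \<iota>)"] bounded_clinear_s_qt by auto
  from closure_of_subset[OF this] T show ?thesis by (auto simp: Gamma_qt_def)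
qed

lemma t_eq_1_if_tracial:
  fixes x y :: 'a
  assumes trace: "\<forall>x\<in>Gamma_qt q t \<iota>. \<forall>y\<in>Gamma_qt q t \<iota>. vacuum_state \<iota> (x \<circ> y) = vacuum_state \<iota> (y \<circ> x)"
    and xy: "x \<bullet> y = 0" "x \<noteq> 0" "y \<noteq> 0"
  shows "t = 1"
proof -
  let ?X = "s_qt q t \<iota> x" and ?Y = "s_qt q t \<iota> y"
  have "?X \<in> Gamma_qt q t \<iota>" "?X \<circ> (?Y \<circ> ?Y) \<in> Gamma_qt q t \<iota>"
    by (intro star_algebra_in_Gamma star_algebra.mult star_algebra.generator rangeI)+
  with trace have "vacuum_state \<iota> (?X \<circ> (?X \<circ> (?Y \<circ> ?Y))) = vacuum_state \<iota> ((?X \<circ> (?Y \<circ> ?Y)) \<circ> ?X)"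
    by blast
  then have "(x \<bullet> x) * (y \<bullet> y) = t * ((x \<bullet> x) * (y \<bullet> y))"
    unfolding vacuum_state_s_qt_words[OF xy(1)] of_real_eq_iff .
  with xy(2,3) show ?thesis by simp
qed

end

text \<open>One Gram-Schmidt step; independence keeps the second vector nonzero.\<close>

lemma independent_pair_orthogonal:
  fixes B :: "'a::real_inner set"
  assumes "independent B" "card B = 2"
  obtains x y :: 'a where "x \<bullet> y = 0" "x \<noteq> 0" "y \<noteq> 0"
proof -
  obtain a b where B: "B = {a, b}" "a \<noteq> b" using assms(2) by (auto simp: card_2_iff)
  define y where "y = b - ((a \<bullet> b) / (a \<bullet> a)) *\<^sub>R a"
  have a: "a \<noteq> 0" using assms(1) B dependent_zero by blast
  have "y \<noteq> 0"
  proof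
    assume "y = 0"
    then have "b = ((a \<bullet> b) / (a \<bullet> a)) *\<^sub>R a" by (simp add: y_def)
    then have "b \<in> span (B - {b})"
      using B by (metis insertI1 insert_Diff_if singletonD span_base span_scale)
    then show False using assms(1) B by (auto simp: dependent_def)
  qed
  moreover have "a \<bullet> y = 0" using a by (simp add: y_def inner_diff_right)
  ultimately show ?thesis using that a by blast
qed

theorem proposition1:
  fixes q t :: real
    and \<iota> :: "'a::{real_inner, complete_space} fock \<Rightarrow> 'k::complex_hilbert"
  assumes "separable_space (euclidean :: 'a topology)"
    and "\<exists>B :: 'a set. independent B \<and> card B = 2"
    and "\<bar>q\<bar> < t" and "t \<le> 1"
    and "fock_completion q t \<iota>"
  shows "(\<forall>x\<in>Gamma_qt q t \<iota>. \<forall>y\<in>Gamma_qt q t \<iota>.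
      vacuum_state \<iota> (x \<circ> y) = vacuum_state \<iota> (y \<circ> x)) \<longleftrightarrow> t = 1"
proof -
  interpret fock_space q t \<iota> using assms(3-5) by unfold_locales
  obtain B :: "'a set" where "independent B" "card B = 2" using assms(2) by blast
  then obtain x y :: 'a where "x \<bullet> y = 0" "x \<noteq> 0" "y \<noteq> 0" by (rule independent_pair_orthogonal)
  then show ?thesis using t_eq_1_if_tracial tracial_if_t_eq_1 by blast
qed

end
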